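(* Let $n\ge1$, let $F(x,y_0,y_1,\dots,y_n)$ be a function holomorphic near $0\in\mathbb{C}^{n+2}$, and let the generalized power series $\varphi=\sum_{k=1}^{\infty}c_kx^{\lambda_k}$ (with $\mathrm{Re}\,\lambda_1>0$) formally satisfy the differential equation $F(x,y,\delta y,\dots,\delta^n y)=0$. Suppose that $$F'_{y_j}(x,\varphi,\delta\varphi,\ldots,\delta^n\varphi)=A_jx^{\nu}+o(x^\nu)\in\mathcal{G},\qquad j=0,1,\dots,n,$$ where $A_j\in\mathbb{C}$, the number $\nu\in\mathbb{C}$ is the same for all $j=0,1,\ldots,n$, and $A_n\ne0$. Then the series $\varphi$ uniformly converges in each sector $S$ of sufficiently small radius with the vertex at the origin and of opening less than $2\pi$, defining there a holomorphic function.
   Context: A generalized power series is a formal series $\varphi=\sum_{k=1}^{\infty}c_kx^{\lambda_k}$ with $c_k\in\mathbb{C}$ and pairwise distinct $\lambda_k\in\mathbb{C}$ such that $0<\mathrm{Re}\,\lambda_1\le\mathrm{Re}\,\lambda_2\le\dots$ and $\mathrm{Re}\,\lambda_k\to+\infty$ (coefficients may vanish, so finite sums are included). $\mathcal{G}$ denotes the ring of all such series, with a constant term also allowed. $F'_{y_j}$ is the partial derivative $\partial F/\partial y_j$. $o(x^\nu)\in\mathcal{G}$ denotes a generalized power series starting with a power exponent whose real part is strictly greater than $\mathrm{Re}\,\nu$. The operator $\delta=x\frac{d}{dx}$ acts on $\mathcal{G}$ termwise, $\delta x^\lambda=\lambda x^\lambda$. Substituting series of positive-real-part exponents into the Taylor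 series of a function holomorphic near $0$ gives an element of $\mathcal{G}$; $\varphi$ formally satisfies the equation if $F(x,\varphi,\delta\varphi,\dots,\delta^n\varphi)=0$ in $\mathcal{G}$. In a sector with vertex at the origin, $x^{\lambda}$ means $e^{\lambda\ln x}$ for a branch of the logarithm on the sector. *)

theory Defs
  imports "HOL-Analysis.Analysis"
begin

text \<open>A series is identified with its coefficient function (exponent to coefficient). The two
  conditions say that the exponents can be listed as \<open>0\<close> (the constant term), followed by a sequence
  with positive real parts which, if infinite, are non-decreasing and tend to infinity.\<close>

typedef gps =
  "{f :: complex \<Rightarrow> complex. (\<forall>\<mu>. f \<mu> \<noteq> 0 \<longrightarrow> \<mu> = 0 \<or> 0 < Re \<mu>) \<and>
     (\<forall>M. finite {\<mu>. f \<mu> \<noteq> 0 \<and> Re \<mu> \<le> M})}"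
  morphisms gps_nth Abs_gps
  by (rule exI[of _ "\<lambda>_. 0"]) auto

setup_lifting type_definition_gps

lemma gps_eqI: "(\<And>\<mu>. gps_nth f \<mu> = gps_nth g \<mu>) \<Longrightarrow> f = g"
  by (auto simp flip: gps_nth_inject)

lemma gps_nth_supp: "gps_nth f \<mu> \<noteq> 0 \<Longrightarrow> \<mu> = 0 \<or> 0 < Re \<mu>"
  using gps_nth[of f] by blast

lemma gps_nth_Re_nonneg: "gps_nth f \<mu> \<noteq> 0 \<Longrightarrow> 0 \<le> Re \<mu>"
  using gps_nth_supp by fastforce

lemma gps_nth_finite: "finite {\<mu>. gps_nth f \<mu> \<noteq> 0 \<and> Re \<mu> \<le> M}"
  using gps_nth[of f] by blast

lemma gps_supp_subset:
  fixes g h :: "complex \<Rightarrow> complex"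
  assumes "\<forall>M. finite {\<mu>. h \<mu> \<noteq> 0 \<and> Re \<mu> \<le> M}" "\<forall>M. finite {\<mu>. k \<mu> \<noteq> 0 \<and> Re \<mu> \<le> M}"
    and "\<And>\<mu>. g \<mu> \<noteq> 0 \<Longrightarrow> h \<mu> \<noteq> 0 \<or> k \<mu> \<noteq> 0"
  shows "finite {\<mu>. g \<mu> \<noteq> 0 \<and> Re \<mu> \<le> M}"
proof (rule finite_subset)
  show "{\<mu>. g \<mu> \<noteq> 0 \<and> Re \<mu> \<le> M} \<subseteq> {\<mu>. h \<mu> \<noteq> 0 \<and> Re \<mu> \<le> M} \<union> {\<mu>. k \<mu> \<noteq> 0 \<and> Re \<mu> \<le> M}"
    using assms(3) by blast
qed (use assms in blast)

instantiation gps :: comm_ring_1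
begin

lift_definition zero_gps :: gps is "\<lambda>_. 0" by auto

lift_definition one_gps :: gps is "\<lambda>\<mu>. if \<mu> = 0 then 1 else 0"
  by auto

lift_definition plus_gps :: "gps \<Rightarrow> gps \<Rightarrow> gps" is "\<lambda>f g \<mu>. f \<mu> + g \<mu>"
proof (intro conjI allI)
  fix f g :: "complex \<Rightarrow> complex" and M
  assume f: "(\<forall>\<mu>. f \<mu> \<noteq> 0 \<longrightarrow> \<mu> = 0 \<or> 0 < Re \<mu>) \<and> (\<forall>M. finite {\<mu>. f \<mu> \<noteq> 0 \<and> Re \<mu> \<le> M})"
    and g: "(\<forall>\<mu>. g \<mu> \<noteq> 0 \<longrightarrow> \<mu> = 0 \<or> 0 < Re \<mu>) \<and> (\<forall>M. finite {\<mu>. g \<mu> \<noteq> 0 \<and> Re \<mu> \<le> M})"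
  show "finite {\<mu>. f \<mu> + g \<mu> \<noteq> 0 \<and> Re \<mu> \<le> M}"
    by (rule gps_supp_subset[of f g]) (use f g in auto)
  show "f \<mu> + g \<mu> \<noteq> 0 \<longrightarrow> \<mu> = 0 \<or> 0 < Re \<mu>" for \<mu>
    using f g by (cases "f \<mu> = 0") auto
qed

lift_definition uminus_gps :: "gps \<Rightarrow> gps" is "\<lambda>f \<mu>. - f \<mu>"
  by simp

definition minus_gps :: "gps \<Rightarrow> gps \<Rightarrow> gps" where "minus_gps f g = f + (- g)"

lift_definition times_gps :: "gps \<Rightarrow> gps \<Rightarrow> gps" is
  "\<lambda>f g \<mu>. \<Sum>a | f a \<noteq> 0 \<and> g (\<mu> - a) \<noteq> 0. f a * g (\<mu> - a)"
proof (intro conjI allI impI)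
  fix f g :: "complex \<Rightarrow> complex" and M :: real
  assume f: "(\<forall>\<mu>. f \<mu> \<noteq> 0 \<longrightarrow> \<mu> = 0 \<or> 0 < Re \<mu>) \<and> (\<forall>M. finite {\<mu>. f \<mu> \<noteq> 0 \<and> Re \<mu> \<le> M})"
    and g: "(\<forall>\<mu>. g \<mu> \<noteq> 0 \<longrightarrow> \<mu> = 0 \<or> 0 < Re \<mu>) \<and> (\<forall>M. finite {\<mu>. g \<mu> \<noteq> 0 \<and> Re \<mu> \<le> M})"
  have ex: "\<exists>a. f a \<noteq> 0 \<and> g (\<mu> - a) \<noteq> 0"
    if "(\<Sum>a | f a \<noteq> 0 \<and> g (\<mu> - a) \<noteq> 0. f a * g (\<mu> - a)) \<noteq> 0" for \<mu>
    by (rule sum.not_neutral_contains_not_neutral[OF that]) blast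
  have nonneg: "0 \<le> Re a" if "f a \<noteq> 0 \<or> g a \<noteq> 0" for a
    using f g that by fastforce
  show "\<mu> = 0 \<or> 0 < Re \<mu>"
    if nz: "(\<Sum>a | f a \<noteq> 0 \<and> g (\<mu> - a) \<noteq> 0. f a * g (\<mu> - a)) \<noteq> 0" for \<mu>
  proof -
    obtain a where a: "f a \<noteq> 0" "g (\<mu> - a) \<noteq> 0" using ex[OF nz] by blast
    have "a = 0 \<or> 0 < Re a" "\<mu> - a = 0 \<or> 0 < Re (\<mu> - a)" using a f g by blast+
    then show ?thesis by auto
  qed
  show "finite {\<mu>. (\<Sum>a | f a \<noteq> 0 \<and> g (\<mu> - a) \<noteq> 0. f a * g (\<mu> - a)) \<noteq> 0 \<and> Re \<mu> \<le> M}"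
  proof (rule finite_subset)
    show "{\<mu>. (\<Sum>a | f a \<noteq> 0 \<and> g (\<mu> - a) \<noteq> 0. f a * g (\<mu> - a)) \<noteq> 0 \<and> Re \<mu> \<le> M}
      \<subseteq> (\<lambda>(a, b). a + b) ` ({\<mu>. f \<mu> \<noteq> 0 \<and> Re \<mu> \<le> M} \<times> {\<mu>. g \<mu> \<noteq> 0 \<and> Re \<mu> \<le> M})"
    proof
      fix \<mu>
      assume "\<mu> \<in> {\<mu>. (\<Sum>a | f a \<noteq> 0 \<and> g (\<mu> - a) \<noteq> 0. f a * g (\<mu> - a)) \<noteq> 0 \<and> Re \<mu> \<le> M}"
      then obtain a where a: "f a \<noteq> 0" "g (\<mu> - a) \<noteq> 0" "Re \<mu> \<le> M" using ex by blast
      have "0 \<le> Re a" "0 \<le> Re (\<mu> - a)" using a nonneg by blast+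
      then show "\<mu> \<in> (\<lambda>(a, b). a + b) `
          ({\<mu>. f \<mu> \<noteq> 0 \<and> Re \<mu> \<le> M} \<times> {\<mu>. g \<mu> \<noteq> 0 \<and> Re \<mu> \<le> M})"
        using a by (intro image_eqI[of _ _ "(a, \<mu> - a)"]) auto
    qed
  qed (use f g in auto)
qed

lemma gps_nth_times:
  assumes "finite A" "{a. gps_nth f a \<noteq> 0 \<and> Re a \<le> Re \<mu>} \<subseteq> A"
  shows "gps_nth (f * g) \<mu> = (\<Sum>a\<in>A. gps_nth f a * gps_nth g (\<mu> - a))"
  unfolding times_gps.rep_eq
proof (rule sum.mono_neutral_left)
  show "{a. gps_nth f a \<noteq> 0 \<and> gps_nth g (\<mu> - a) \<noteq> 0} \<subseteq> A"
  proof
    fix a assume a: "a \<in> {a. gps_nth f a \<noteq> 0 \<and> gps_nth g (\<mu> - a) \<noteq> 0}"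
    then have "0 \<le> Re (\<mu> - a)" using gps_nth_Re_nonneg by blast
    then show "a \<in> A" using a assms(2) by auto
  qed
qed (use assms in auto)

lemma gps_times_comm: "f * g = g * (f :: gps)"
proof (rule gps_eqI)
  fix \<mu>
  show "gps_nth (f * g) \<mu> = gps_nth (g * f) \<mu>"
    unfolding times_gps.rep_eq
    by (rule sum.reindex_bij_witness[of _ "\<lambda>a. \<mu> - a" "\<lambda>a. \<mu> - a"]) auto
qed

lemma gps_nth_times':
  assumes "finite A" "{a. gps_nth g a \<noteq> 0 \<and> Re a \<le> Re \<mu>} \<subseteq> A"
  shows "gps_nth (f * g) \<mu> = (\<Sum>a\<in>A. gps_nth f (\<mu> - a) * gps_nth g a)"
  by (simp add: gps_times_comm[of f] gps_nth_times[OF assms] mult.commute)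

instance
proof
  fix f g h :: gps
  show "f * g * h = f * (g * h)"
  proof (rule gps_eqI)
    fix \<mu>
    define S where "S = {a. gps_nth f a \<noteq> 0 \<and> Re a \<le> Re \<mu>}"
    define T where "T = {a. gps_nth h a \<noteq> 0 \<and> Re a \<le> Re \<mu>}"
    have fin: "finite S" "finite T" by (simp_all add: S_def T_def gps_nth_finite)
    have S: "0 \<le> Re a" if "a \<in> S" for a using that gps_nth_Re_nonneg by (auto simp: S_def)
    have T: "0 \<le> Re a" if "a \<in> T" for a using that gps_nth_Re_nonneg by (auto simp: T_def)
    have "gps_nth (f * g * h) \<mu> = (\<Sum>c\<in>T. gps_nth (f * g) (\<mu> - c) * gps_nth h c)"
      by (rule gps_nth_times') (auto simp: fin T_def gps_nth_finite)
    also have "\<dots> = (\<Sum>c\<in>T. \<Sum>a\<in>S. gps_nth f a * gps_nth g (\<mu> - c - a) * gps_nth h c)"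
    proof (rule sum.cong[OF refl])
      fix c assume "c \<in> T"
      then have "{a. gps_nth f a \<noteq> 0 \<and> Re a \<le> Re (\<mu> - c)} \<subseteq> S"
        using T[of c] by (auto simp: S_def)
      from gps_nth_times[OF fin(1) this]
      show "gps_nth (f * g) (\<mu> - c) * gps_nth h c =
          (\<Sum>a\<in>S. gps_nth f a * gps_nth g (\<mu> - c - a) * gps_nth h c)"
        by (simp add: sum_distrib_right)
    qed
    also have "\<dots> = (\<Sum>a\<in>S. \<Sum>c\<in>T. gps_nth f a * gps_nth g (\<mu> - c - a) * gps_nth h c)"
      by (rule sum.swap)
    also have "\<dots> = (\<Sum>a\<in>S. gps_nth f a * gps_nth (g * h) (\<mu> - a))"
    proof (rule sum.cong[OF refl])
      fix a assume "a \<in> S"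
      then have "{c. gps_nth h c \<noteq> 0 \<and> Re c \<le> Re (\<mu> - a)} \<subseteq> T"
        using S[of a] by (auto simp: T_def)
      note * = gps_nth_times'[OF fin(2) this]
      show "(\<Sum>c\<in>T. gps_nth f a * gps_nth g (\<mu> - c - a) * gps_nth h c) =
          gps_nth f a * gps_nth (g * h) (\<mu> - a)"
        unfolding * sum_distrib_left
        by (rule sum.cong[OF refl]) (simp add: algebra_simps)
    qed
    also have "\<dots> = gps_nth (f * (g * h)) \<mu>"
      by (rule gps_nth_times[symmetric]) (auto simp: fin S_def gps_nth_finite)
    finally show "gps_nth (f * g * h) \<mu> = gps_nth (f * (g * h)) \<mu>" .
  qed
  show "f * g = g * f" by (rule gps_times_comm)
  show "1 * f = f"
    by (rule gps_eqI, subst gps_nth_times[where A = "{0}"])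
      (auto simp: one_gps.rep_eq split: if_splits)
  show "(f + g) * h = f * h + g * h"
  proof (rule gps_eqI)
    fix \<mu>
    define T where "T = {a. gps_nth h a \<noteq> 0 \<and> Re a \<le> Re \<mu>}"
    have "finite T" by (simp add: T_def gps_nth_finite)
    then have *: "gps_nth (k * h) \<mu> = (\<Sum>c\<in>T. gps_nth k (\<mu> - c) * gps_nth h c)" for k
      by (rule gps_nth_times') (auto simp: T_def)
    show "gps_nth ((f + g) * h) \<mu> = gps_nth (f * h + g * h) \<mu>"
      by (simp add: * plus_gps.rep_eq sum.distrib distrib_right)
  qed
  show "f + g + h = f + (g + h)" "f + g = g + f" "0 + f = f" "- f + f = 0" "f - g = f + - g"
    by (auto intro!: gps_eqI simp: minus_gps_def plus_gps.rep_eq zero_gps.rep_eq uminus_gps.rep_eq)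
  show "(0 :: gps) \<noteq> 1"
    by (metis zero_gps.rep_eq one_gps.rep_eq zero_neq_one)
qed

end

lift_definition gps_X :: gps is "\<lambda>\<mu>. if \<mu> = 1 then 1 else 0"
  by auto

text \<open>The derivation \<open>\<delta> = x d/dx\<close>.\<close>

lift_definition gps_delta :: "gps \<Rightarrow> gps" is "\<lambda>f \<mu>. \<mu> * f \<mu>"
proof (intro conjI allI)
  fix f :: "complex \<Rightarrow> complex" and M
  assume f: "(\<forall>\<mu>. f \<mu> \<noteq> 0 \<longrightarrow> \<mu> = 0 \<or> 0 < Re \<mu>) \<and> (\<forall>M. finite {\<mu>. f \<mu> \<noteq> 0 \<and> Re \<mu> \<le> M})"
  show "finite {\<mu>. \<mu> * f \<mu> \<noteq> 0 \<and> Re \<mu> \<le> M}"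
    by (rule gps_supp_subset[of f f]) (use f in auto)
  show "\<mu> * f \<mu> \<noteq> 0 \<longrightarrow> \<mu> = 0 \<or> 0 < Re \<mu>" for \<mu>
    using f by auto
qed

text \<open>Exponent sequences start at index \<open>0\<close>; coefficients may vanish, so finite sums are covered.\<close>

definition gps_exponents :: "(nat \<Rightarrow> complex) \<Rightarrow> bool" where
  "gps_exponents lam \<longleftrightarrow> inj lam \<and> 0 < Re (lam 0) \<and> (\<forall>k. Re (lam k) \<le> Re (lam (Suc k))) \<and>
     filterlim (\<lambda>k. Re (lam k)) at_top sequentially"

text \<open>The coefficient function really lies in the ring whenever \<open>lam\<close> is admissible; see
  \<open>gps_nth_series\<close> and \<open>gps_nth_series_lam\<close>.\<close>

definition gps_series :: "(nat \<Rightarrow> complex) \<Rightarrow> (nat \<Rightarrow> complex) \<Rightarrow> gps" where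
  "gps_series c lam = Abs_gps (\<lambda>\<mu>. \<Sum>k | lam k = \<mu>. c k)"

lemma gps_exponents_Re_pos:
  assumes "gps_exponents lam"
  shows "0 < Re (lam k)"
  using assms by (induction k) (auto simp: gps_exponents_def intro: less_le_trans)

lemma gps_nth_series:
  assumes "gps_exponents lam"
  shows "gps_nth (gps_series c lam) \<mu> = (\<Sum>k | lam k = \<mu>. c k)"
proof -
  have ex: "\<exists>k. lam k = \<mu>" if "(\<Sum>k | lam k = \<mu>. c k) \<noteq> 0" for \<mu>
    by (rule sum.not_neutral_contains_not_neutral[OF that]) blast
  have "finite {\<mu>. (\<Sum>k | lam k = \<mu>. c k) \<noteq> 0 \<and> Re \<mu> \<le> M}" for M
  proof -
    have "eventually (\<lambda>k. M + 1 \<le> Re (lam k)) sequentially"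
      using assms by (auto simp: gps_exponents_def filterlim_at_top)
    then obtain K where K: "\<And>k. k \<ge> K \<Longrightarrow> M + 1 \<le> Re (lam k)"
      by (auto simp: eventually_sequentially)
    have "{\<mu>. (\<Sum>k | lam k = \<mu>. c k) \<noteq> 0 \<and> Re \<mu> \<le> M} \<subseteq> lam ` {..<K}"
    proof
      fix \<mu> assume "\<mu> \<in> {\<mu>. (\<Sum>k | lam k = \<mu>. c k) \<noteq> 0 \<and> Re \<mu> \<le> M}"
      then obtain k where k: "lam k = \<mu>" "Re \<mu> \<le> M" using ex by blast
      then have "\<not> k \<ge> K" using K[of k] by auto
      then show "\<mu> \<in> lam ` {..<K}" using k by auto
    qed
    then show ?thesis by (rule finite_subset) simp
  qed
  moreover have "\<mu> = 0 \<or> 0 < Re \<mu>" if "(\<Sum>k | lam k = \<mu>. c k) \<noteq> 0" for \<mu>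
    using ex[OF that] gps_exponents_Re_pos[OF assms] by blast
  ultimately show ?thesis
    unfolding gps_series_def by (subst Abs_gps_inverse) auto
qed

lemma gps_nth_series_lam:
  assumes "gps_exponents lam"
  shows "gps_nth (gps_series c lam) (lam k) = c k"
proof -
  have "{j. lam j = lam k} = {k}"
    using assms by (auto simp: gps_exponents_def inj_eq)
  then show ?thesis by (simp add: gps_nth_series[OF assms])
qed

lemma gps_nth_series_0:
  assumes "gps_exponents lam"
  shows "gps_nth (gps_series c lam) 0 = 0"
proof -
  have "lam j \<noteq> 0" for j
    using gps_exponents_Re_pos[OF assms, of j] by auto
  then show ?thesis by (simp add: gps_nth_series[OF assms])
qed

text \<open>\<open>R = o(x\<^sup>\<nu>)\<close>, and \<open>g = A x\<^sup>\<nu> + o(x\<^sup>\<nu>)\<close>. The latter is stated on coefficients because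
  \<open>x\<^sup>\<nu>\<close> itself belongs to the ring only if \<open>\<nu> = 0\<close> or \<open>Re \<nu> > 0\<close> (which holds
  whenever the relation holds with \<open>A \<noteq> 0\<close>).\<close>

definition gps_small_o :: "complex \<Rightarrow> gps \<Rightarrow> bool" where
  "gps_small_o \<nu> R \<longleftrightarrow> (\<forall>\<mu>. gps_nth R \<mu> \<noteq> 0 \<longrightarrow> Re \<nu> < Re \<mu>)"

definition gps_leading :: "gps \<Rightarrow> complex \<Rightarrow> complex \<Rightarrow> bool" where
  "gps_leading g A \<nu> \<longleftrightarrow>
     (\<exists>R. gps_small_o \<nu> R \<and> (\<forall>\<mu>. gps_nth g \<mu> = (if \<mu> = \<nu> then A else 0) + gps_nth R \<mu>))"

text \<open>Frechet differentiability near \<open>a\<close> with complex-linear derivative.\<close>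

definition holomorphic_near :: "(complex ^ 'm \<Rightarrow> complex) \<Rightarrow> complex ^ 'm \<Rightarrow> bool" where
  "holomorphic_near F a \<longleftrightarrow> (\<exists>U. open U \<and> a \<in> U \<and>
     (\<forall>z\<in>U. \<exists>D. (F has_derivative D) (at z) \<and> (\<forall>c h. D (c *s h) = c * D h)))"

definition cpartial :: "'m \<Rightarrow> (complex ^ 'm \<Rightarrow> complex) \<Rightarrow> (complex ^ 'm \<Rightarrow> complex)" where
  "cpartial i F z = deriv (\<lambda>t. F (\<chi> k. if k = i then t else z $ k)) (z $ i)"

text \<open>Multi-indices are functions \<open>\<alpha> :: 'm \<Rightarrow> nat\<close>. The enumeration \<open>v\<close> of the variables
  fixes the order in which the partial derivatives are taken; for holomorphic functions they
  commute.\<close>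

definition taylor_coeff ::
    "(nat \<Rightarrow> 'm::finite) \<Rightarrow> (complex ^ 'm \<Rightarrow> complex) \<Rightarrow> ('m \<Rightarrow> nat) \<Rightarrow> complex" where
  "taylor_coeff v F \<alpha> =
     foldr (\<lambda>j. cpartial (v j) ^^ \<alpha> (v j)) [0..<CARD('m)] F 0 / (\<Prod>i\<in>UNIV. fact (\<alpha> i))"

definition gps_monomial :: "(nat \<Rightarrow> 'm::finite) \<Rightarrow> (nat \<Rightarrow> gps) \<Rightarrow> ('m \<Rightarrow> nat) \<Rightarrow> gps" where
  "gps_monomial v Y \<alpha> = (\<Prod>j<CARD('m). Y j ^ \<alpha> (v j))"

text \<open>Substitution of \<open>Y j\<close> for the variable \<open>v j\<close> in the Taylor series of \<open>F\<close> at \<open>0\<close>. If no \<open>Y j\<close>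
  has a constant term, only finitely many multi-indices contribute to a given exponent, and the
  result is an element of the ring; see \<open>finite_gps_monomial\<close> and \<open>gps_nth_subst\<close>.\<close>

definition gps_subst ::
    "(nat \<Rightarrow> 'm::finite) \<Rightarrow> (complex ^ 'm \<Rightarrow> complex) \<Rightarrow> (nat \<Rightarrow> gps) \<Rightarrow> gps" where
  "gps_subst v F Y = Abs_gps (\<lambda>\<mu>.
     \<Sum>\<alpha> | gps_nth (gps_monomial v Y \<alpha>) \<mu> \<noteq> 0. taylor_coeff v F \<alpha> * gps_nth (gps_monomial v Y \<alpha>) \<mu>)"

text \<open>The arguments \<open>(x, \<phi>, \<delta> \<phi>, \<delta>\<^sup>2 \<phi>, \<dots>)\<close>.\<close>

definition gps_jet :: "gps \<Rightarrow> nat \<Rightarrow> gps" where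
  "gps_jet \<phi> = case_nat gps_X (\<lambda>j. (gps_delta ^^ j) \<phi>)"


definition gps_ge :: "real \<Rightarrow> gps \<Rightarrow> bool" where
  "gps_ge d f \<longleftrightarrow> (\<forall>\<mu>. gps_nth f \<mu> \<noteq> 0 \<longrightarrow> d \<le> Re \<mu>)"

lemma gps_ge_one: "gps_ge 0 1"
  by (auto simp: gps_ge_def one_gps.rep_eq)

lemma gps_ge_times:
  assumes "gps_ge a f" "gps_ge b g"
  shows "gps_ge (a + b) (f * g)"
  unfolding gps_ge_def
proof (intro allI impI)
  fix \<mu> assume "gps_nth (f * g) \<mu> \<noteq> 0"
  then obtain c where "gps_nth f c \<noteq> 0" "gps_nth g (\<mu> - c) \<noteq> 0"
    unfolding times_gps.rep_eq by (elim sum.not_neutral_contains_not_neutral) blast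
  then have "a \<le> Re c" "b \<le> Re (\<mu> - c)" using assms by (auto simp: gps_ge_def)
  then show "a + b \<le> Re \<mu>" by simp
qed

lemma gps_ge_power: "gps_ge a f \<Longrightarrow> gps_ge (real n * a) (f ^ n)"
proof (induction n)
  case (Suc n)
  then have "gps_ge (a + real n * a) (f ^ Suc n)" by (simp add: gps_ge_times)
  then show ?case by (simp add: algebra_simps)
qed (simp add: gps_ge_one)

lemma gps_ge_prod:
  fixes N :: nat
  shows "(\<And>j. j < N \<Longrightarrow> gps_ge (d j) (Y j)) \<Longrightarrow> gps_ge (\<Sum>j<N. d j) (\<Prod>j<N. Y j)"
  by (induction N) (auto simp: gps_ge_one gps_ge_times)

lemma gps_ge_exists:
  assumes "gps_nth f 0 = 0"
  shows "\<exists>e>0. gps_ge e f"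
proof -
  define S where "S = insert 1 (Re ` {\<mu>. gps_nth f \<mu> \<noteq> 0 \<and> Re \<mu> \<le> 1})"
  have S: "finite S" "S \<noteq> {}" by (simp_all add: S_def gps_nth_finite)
  have "0 < Min S"
    using S assms by (subst Min_gr_iff) (auto simp: S_def dest: gps_nth_supp)
  moreover have "Min S \<le> Re \<mu>" if "gps_nth f \<mu> \<noteq> 0" for \<mu>
  proof (cases "Re \<mu> \<le> 1")
    case True
    then show ?thesis using S that by (intro Min_le) (auto simp: S_def)
  next
    case False
    moreover have "Min S \<le> 1" using S by (intro Min_le) (auto simp: S_def)
    ultimately show ?thesis by simp
  qed
  ultimately show ?thesis unfolding gps_ge_def by blast
qed

lemma finite_gps_monomial_le:
  fixes v :: "nat \<Rightarrow> 'm::finite"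
  assumes v: "bij_betw v {..<CARD('m)} UNIV" and Y: "\<And>j. j < CARD('m) \<Longrightarrow> gps_nth (Y j) 0 = 0"
  shows "finite {\<alpha>. \<exists>\<mu>. gps_nth (gps_monomial v Y \<alpha>) \<mu> \<noteq> 0 \<and> Re \<mu> \<le> M}"
proof -
  obtain e where e: "\<And>j. j < CARD('m) \<Longrightarrow> 0 < e j \<and> gps_ge (e j) (Y j)"
    using gps_ge_exists[OF Y] by metis
  define K where "K = Max ((\<lambda>j. nat \<lceil>M / e j\<rceil>) ` {..<CARD('m)})"
  have "{\<alpha>. \<exists>\<mu>. gps_nth (gps_monomial v Y \<alpha>) \<mu> \<noteq> 0 \<and> Re \<mu> \<le> M} \<subseteq> (UNIV \<rightarrow>\<^sub>E {..K})"
  proof (clarsimp simp: PiE_UNIV_domain)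
    fix \<alpha> i \<mu>
    assume nz: "gps_nth (gps_monomial v Y \<alpha>) \<mu> \<noteq> 0" and le: "Re \<mu> \<le> M"
    obtain j where j: "j < CARD('m)" "v j = i"
      using v by (metis UNIV_I bij_betw_iff_bijections lessThan_iff)
    have "gps_ge (\<Sum>j<CARD('m). real (\<alpha> (v j)) * e j) (gps_monomial v Y \<alpha>)"
      unfolding gps_monomial_def by (intro gps_ge_prod gps_ge_power) (use e in auto)
    then have "(\<Sum>j<CARD('m). real (\<alpha> (v j)) * e j) \<le> M"
      using nz le unfolding gps_ge_def by fastforce
    moreover have "real (\<alpha> (v j)) * e j \<le> (\<Sum>j<CARD('m). real (\<alpha> (v j)) * e j)"
      using j e by (intro member_le_sum mult_nonneg_nonneg) (auto intro: less_imp_le)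
    ultimately have "real (\<alpha> i) \<le> M / e j"
      using e[OF j(1)] j by (simp add: pos_le_divide_eq)
    then have "\<alpha> i \<le> nat \<lceil>M / e j\<rceil>" by linarith
    also have "\<dots> \<le> K" unfolding K_def using j by (intro Max_ge) auto
    finally show "\<alpha> i \<le> K" .
  qed
  then show ?thesis by (rule finite_subset) (intro finite_PiE, auto)
qed

lemma finite_gps_monomial:
  fixes v :: "nat \<Rightarrow> 'm::finite"
  assumes "bij_betw v {..<CARD('m)} UNIV" and "\<And>j. j < CARD('m) \<Longrightarrow> gps_nth (Y j) 0 = 0"
  shows "finite {\<alpha>. gps_nth (gps_monomial v Y \<alpha>) \<mu> \<noteq> 0}"
  by (rule finite_subset[OF _ finite_gps_monomial_le[OF assms, where M = "Re \<mu>"]]) auto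

lemma gps_nth_subst:
  fixes v :: "nat \<Rightarrow> 'm::finite"
  assumes "bij_betw v {..<CARD('m)} UNIV" and "\<And>j. j < CARD('m) \<Longrightarrow> gps_nth (Y j) 0 = 0"
  shows "gps_nth (gps_subst v F Y) \<mu> = (\<Sum>\<alpha> | gps_nth (gps_monomial v Y \<alpha>) \<mu> \<noteq> 0.
           taylor_coeff v F \<alpha> * gps_nth (gps_monomial v Y \<alpha>) \<mu>)"
proof -
  let ?f = "\<lambda>\<mu>. \<Sum>\<alpha> | gps_nth (gps_monomial v Y \<alpha>) \<mu> \<noteq> 0.
              taylor_coeff v F \<alpha> * gps_nth (gps_monomial v Y \<alpha>) \<mu>"
  have ex: "\<exists>\<alpha>. gps_nth (gps_monomial v Y \<alpha>) \<mu> \<noteq> 0" if "?f \<mu> \<noteq> 0" for \<mu>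
    by (rule sum.not_neutral_contains_not_neutral[OF that]) blast
  have "finite {\<mu>. ?f \<mu> \<noteq> 0 \<and> Re \<mu> \<le> M}" for M
  proof -
    let ?A = "{\<alpha>. \<exists>\<mu>. gps_nth (gps_monomial v Y \<alpha>) \<mu> \<noteq> 0 \<and> Re \<mu> \<le> M}"
    have "{\<mu>. ?f \<mu> \<noteq> 0 \<and> Re \<mu> \<le> M} \<subseteq>
        (\<Union>\<alpha>\<in>?A. {\<mu>. gps_nth (gps_monomial v Y \<alpha>) \<mu> \<noteq> 0 \<and> Re \<mu> \<le> M})"
      using ex by blast
    then show ?thesis
      by (rule finite_subset) (simp add: finite_gps_monomial_le[OF assms] gps_nth_finite)
  qed
  moreover have "\<mu> = 0 \<or> 0 < Re \<mu>" if "?f \<mu> \<noteq> 0" for \<mu>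
    using ex[OF that] gps_nth_supp by blast
  ultimately show ?thesis
    unfolding gps_subst_def by (subst Abs_gps_inverse) auto
qed

lemma gps_nth_jet_0:
  assumes "gps_nth \<phi> 0 = 0"
  shows "gps_nth (gps_jet \<phi> j) 0 = 0"
proof (cases j)
  case (Suc i)
  have "gps_nth ((gps_delta ^^ i) \<phi>) 0 = 0"
    by (induction i) (auto simp: assms gps_delta.rep_eq)
  then show ?thesis by (simp add: gps_jet_def Suc)
qed (simp add: gps_jet_def gps_X.rep_eq)

definition sector :: "real \<Rightarrow> real \<Rightarrow> real \<Rightarrow> complex set" where
  "sector \<theta>1 \<theta>2 r = {rcis \<rho> \<theta> | \<rho> \<theta>. 0 < \<rho> \<and> \<rho> < r \<and> \<theta>1 < \<theta> \<and> \<theta> < \<theta>2}"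

definition log_branch :: "complex set \<Rightarrow> (complex \<Rightarrow> complex) \<Rightarrow> bool" where
  "log_branch S L \<longleftrightarrow> L holomorphic_on S \<and> (\<forall>x\<in>S. exp (L x) = x)"

end

theory Submission
  imports Defs "HOL-Complex_Analysis.Conformal_Mappings"
begin

text \<open>Weight a coefficient at \<open>\<mu>\<close> by \<open>w \<mu> = exp (\<Theta> \<bar>Im \<mu>\<bar> - t Re \<mu>)\<close>, which is submultiplicative and dominates
  \<open>\<bar>x\<^sup>\<mu>\<bar>\<close> for \<open>\<bar>x\<bar> \<le> exp (- t)\<close> and \<open>\<bar>arg x\<bar> \<le> \<Theta>\<close>; hence it suffices to bound the weighted sums of the
  coefficients of \<open>\<phi>\<close> over all exponents with \<open>Re \<mu> \<le> M\<close>, uniformly in \<open>M\<close>, for some \<open>t\<close>. Split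
  \<open>\<phi> = P + \<psi>\<close> at a large real part \<open>m\<close> and expand \<open>F\<close> to first order at \<open>P\<close>. With \<open>F\<^sub>j\<close> for the partial
  derivatives, \<open>F\<^sub>j(P) = A\<^sub>j x\<^sup>\<nu> + B\<^sub>j\<close> with \<open>B\<^sub>j = o(x\<^sup>\<nu>)\<close>, so that
  \<open>x\<^sup>\<nu> (\<Sum>j\<le>n. A\<^sub>j \<delta>\<^sup>j \<psi>) = - F(P) - (\<Sum>j\<le>n. B\<^sub>j \<delta>\<^sup>j \<psi>) - Q\<close> with \<open>Q\<close> quadratic in \<open>\<psi>\<close>. As \<open>A\<^sub>n \<noteq> 0\<close>, the
  polynomial \<open>\<Sum>j\<le>n. A\<^sub>j \<mu>\<^sup>j\<close> dominates every \<open>\<mu>\<^sup>j\<close> with \<open>j \<le> n\<close> once \<open>Re \<mu> > m\<close>. This bounds the weighted sums of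
  \<open>\<delta>\<^sup>j \<psi>\<close> up to \<open>M\<close> by those up to \<open>M - \<epsilon>\<close>, with constants that become small for large \<open>t\<close>, and
  induction on \<open>M\<close> closes the estimate.\<close>

subsection \<open>Holomorphic functions of several variables\<close>

definition cupd :: "complex ^ 'm \<Rightarrow> 'm \<Rightarrow> complex \<Rightarrow> complex ^ 'm" where
  "cupd z i t = (\<chi> k. if k = i then t else z $ k)"

definition polydisc :: "real \<Rightarrow> (complex ^ 'm) set" where
  "polydisc r = {z. \<forall>i. norm (z $ i) < r}"

text \<open>Separate holomorphy together with boundedness on smaller polydiscs amounts to joint
  holomorphy (Osgood). In this form only one-variable tools are needed, and the property passes to
  \<open>cpartial\<close>.\<close>

definition sep_holo :: "real \<Rightarrow> (complex ^ 'm \<Rightarrow> complex) \<Rightarrow> bool" where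
  "sep_holo r f \<longleftrightarrow>
     (\<forall>z\<in>polydisc r. \<forall>i. (\<lambda>t. f (cupd z i t)) holomorphic_on ball 0 r) \<and>
     (\<forall>s<r. \<exists>B. \<forall>z\<in>polydisc s. norm (f z) \<le> B)"

lemma cpartial_cupd: "cpartial i f z = deriv (\<lambda>t. f (cupd z i t)) (z $ i)"
  by (simp add: cpartial_def cupd_def)

lemma cupd_nth [simp]: "cupd z i t $ k = (if k = i then t else z $ k)"
  by (simp add: cupd_def)

lemma cupd_cupd [simp]: "cupd (cupd z i s) i t = cupd z i t"
  by (simp add: vec_eq_iff)

lemma cupd_self [simp]: "cupd z i (z $ i) = z"
  by (simp add: vec_eq_iff)

lemma cupd_commute: "i \<noteq> j \<Longrightarrow> cupd (cupd z i s) j t = cupd (cupd z j t) i s"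
  by (auto simp: vec_eq_iff)

lemma cupd_in_polydisc: "z \<in> polydisc r \<Longrightarrow> norm t < r \<Longrightarrow> cupd z i t \<in> polydisc r"
  by (auto simp: polydisc_def)

lemma polydisc_nth: "z \<in> polydisc r \<Longrightarrow> norm (z $ i) < r"
  by (simp add: polydisc_def)

lemma polydisc_mono: "s \<le> r \<Longrightarrow> polydisc s \<subseteq> polydisc r"
  unfolding polydisc_def using less_le_trans by blast

lemma polydisc_shrink:
  fixes z :: "complex ^ 'm::finite"
  assumes "z \<in> polydisc r" "norm w < r"
  obtains s where "0 < s" "s < r" "z \<in> polydisc s" "norm w < s"
proof -
  define S where "S = insert (norm w) (range (\<lambda>i. norm (z $ i)))"
  have S: "finite S" "S \<noteq> {}" by (simp_all add: S_def)
  have "Max S < r"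
    using assms S by (subst Max_less_iff) (auto simp: S_def polydisc_def)
  then obtain s where s: "Max S < s" "s < r" using dense by blast
  have "x < s" if "x \<in> S" for x
    using Max_ge[OF S(1) that] s by simp
  then have "z \<in> polydisc s" "norm w < s" by (auto simp: S_def polydisc_def)
  then show thesis using that[of s] s norm_ge_zero[of w] by linarith
qed

lemma sep_holo_slice:
  "sep_holo r f \<Longrightarrow> z \<in> polydisc r \<Longrightarrow> (\<lambda>t. f (cupd z i t)) holomorphic_on ball 0 r"
  by (simp add: sep_holo_def)

lemma sep_holo_bound:
  assumes "sep_holo r f" "s < r"
  obtains B where "0 \<le> B" "\<And>z. z \<in> polydisc s \<Longrightarrow> norm (f z) \<le> B"
proof -
  obtain B where "\<And>z. z \<in> polydisc s \<Longrightarrow> norm (f z) \<le> B"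
    using assms unfolding sep_holo_def by blast
  then show thesis by (intro that[of "max 0 B"]) (auto simp: le_max_iff_disj)
qed

section \<open>Cauchy and Taylor estimates along one variable\<close>

lemma slice_has_derivative:
  assumes "sep_holo r f" "z \<in> polydisc r" "norm w < r"
  shows "((\<lambda>t. f (cupd z i t)) has_field_derivative cpartial i f (cupd z i w)) (at w)"
  using holomorphic_derivI[OF sep_holo_slice[OF assms(1,2)] open_ball, of w] assms(3)
  by (simp add: cpartial_cupd)

text \<open>Cauchy's inequality on the circle of radius \<open>d\<close> about \<open>z\<close>; the
  triangle inequality keeps the closed disc inside \<open>ball 0 r\<close>.\<close>

lemma higher_deriv_bound:
  assumes "g holomorphic_on ball 0 r" "\<And>t. norm t < r \<Longrightarrow> norm (g t) \<le> B" "norm z + d < r" "0 < d"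
  shows "norm ((deriv ^^ k) g z) \<le> fact k * B / d ^ k"
proof -
  have sub: "cball z d \<subseteq> ball 0 r"
  proof
    fix x assume "x \<in> cball z d"
    then have "norm (x - z) \<le> d" by (simp add: dist_norm norm_minus_commute)
    then show "x \<in> ball 0 r" using assms(3) norm_triangle_sub[of x z] by simp
  qed
  show ?thesis
  proof (rule Cauchy_inequality)
    show "g holomorphic_on ball z d"
      using assms(1) sub by (meson ball_subset_cball holomorphic_on_subset order_trans)
    show "continuous_on (cball z d) g"
      using assms(1) sub by (meson holomorphic_on_imp_continuous_on holomorphic_on_subset)
    show "norm (g x) \<le> B" if "norm (z - x) = d" for x
    proof -
      have "x \<in> cball z d" using that by (simp add: dist_norm)
      then show ?thesis using sub assms(2) by fastforce
    qed
  qed (use assms in auto)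
qed

text \<open>The quadratic Taylor remainder. Cauchy's inequality with radius \<open>d\<close> bounds
  the second derivative at every point within \<open>d\<close> of \<open>z\<close>, which explains
  the margin \<open>2 * d\<close>.\<close>

lemma linear_approx_bound:
  assumes "g holomorphic_on ball 0 r" "\<And>t. norm t < r \<Longrightarrow> norm (g t) \<le> B"
    and "norm z + 2 * d < r" "0 < d" "norm h \<le> d"
  shows "norm (g (z + h) - g z - h * deriv g z) \<le> (2 * B / d ^ 2) * norm h ^ 2"
proof -
  have in_r: "norm x + d < r" if "x \<in> cball z d" for x
  proof -
    have "norm (x - z) \<le> d" using that by (simp add: dist_norm norm_minus_commute)
    then show ?thesis using assms(3) norm_triangle_sub[of x z] by simp
  qed
  have "norm (g (z + h) - (\<Sum>i\<le>1. (deriv ^^ i) g z * (z + h - z) ^ i / fact i))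
      \<le> (2 * B / d ^ 2) * norm (z + h - z) ^ Suc 1 / fact 1"
  proof (rule complex_Taylor[of "cball z d" 1 "\<lambda>i. (deriv ^^ i) g", simplified funpow_0])
    fix x i assume x: "x \<in> cball z d"
    have xr: "norm x < r" using in_r[OF x] assms(4) by simp
    have "((deriv ^^ i) g) holomorphic_on ball 0 r"
      by (rule holomorphic_higher_deriv[OF assms(1) open_ball])
    then have "((deriv ^^ i) g has_field_derivative (deriv ^^ Suc i) g x) (at x)"
      using holomorphic_derivI[OF _ open_ball, of "(deriv ^^ i) g" 0 r x] xr by simp
    then show "((deriv ^^ i) g has_field_derivative (deriv ^^ Suc i) g x) (at x within cball z d)"
      by (rule has_field_derivative_at_within)
    show "norm ((deriv ^^ Suc 1) g x) \<le> 2 * B / d ^ 2"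
      using higher_deriv_bound[OF assms(1,2) in_r[OF x] assms(4), of 2]
      by (simp add: numeral_2_eq_2)
  qed (use assms in \<open>auto simp: dist_norm\<close>)
  then show ?thesis by (simp add: power2_eq_square algebra_simps)
qed

text \<open>The difference quotients of \<open>f\<close> in direction \<open>i\<close> are holomorphic in the variable \<open>j\<close> and converge
  locally uniformly, so the Weierstrass theorem gives both the holomorphy of the partial derivative and,
  from the convergence of the derivatives, the symmetry of the mixed ones.\<close>

lemma cpartial_slice_limit:
  fixes f :: "complex ^ 'm::finite \<Rightarrow> complex"
  assumes f: "sep_holo r f" and z: "z \<in> polydisc r" and w: "norm w < r" and "i \<noteq> j"
  obtains D h where
    "((\<lambda>t. cpartial i f (cupd z j t)) has_field_derivative D) (at w)"
    "h \<longlonglongrightarrow> 0" "\<And>N. h N \<noteq> 0"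
    "(\<lambda>N. (cpartial j f (cupd (cupd z j w) i (z $ i + h N)) - cpartial j f (cupd z j w)) / h N) \<longlonglongrightarrow> D"
proof -
  obtain s where s: "0 < s" "s < r" "z \<in> polydisc s" "norm w < s"
    using polydisc_shrink[OF z w] .
  \<comment> \<open>A quarter of the gap: a coordinate of modulus below \<open>s\<close>, moved by
    at most \<open>d\<close>, still has a disc of radius \<open>d\<close> around it inside radius
    \<open>s' = s + 3 * d\<close>, and \<open>s' < r\<close>.\<close>
  define d where "d = (r - s) / 4"
  have d: "0 < d" "s + 2 * d < r" using s by (simp_all add: d_def field_simps)
  define s' where "s' = s + 3 * d"
  have s': "s' < r" using s by (simp add: s'_def d_def field_simps)
  obtain B where B: "0 \<le> B" "\<And>z. z \<in> polydisc s' \<Longrightarrow> norm (f z) \<le> B"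
    using sep_holo_bound[OF f s'] by blast
  define h where "h = (\<lambda>N. complex_of_real (d / real (Suc N)))"
  have h0: "h N \<noteq> 0" for N using d by (simp add: h_def del: of_nat_Suc)
  have hd: "norm (h N) \<le> d" for N
    using d unfolding h_def norm_of_real by (simp add: divide_simps)
  have h_lim: "h \<longlonglongrightarrow> 0"
  proof -
    have "(\<lambda>N. d / real (Suc N)) \<longlonglongrightarrow> 0" using lim_const_over_n[of d] LIMSEQ_Suc by blast
    then have "(\<lambda>N. complex_of_real (d / real (Suc N))) \<longlonglongrightarrow> of_real 0"
      by (rule tendsto_of_real)
    then show ?thesis by (simp add: h_def)
  qed
  define zh where "zh = (\<lambda>N. cupd z i (z $ i + h N))"
  have nh: "norm (z $ i + h N) < s + 2 * d" for N
    using norm_triangle_ineq[of "z $ i" "h N"] polydisc_nth[OF s(3), of i] hd[of N] d by linarith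
  have zh: "zh N \<in> polydisc r" for N
    unfolding zh_def using z nh[of N] d by (intro cupd_in_polydisc) auto
  let ?q = "\<lambda>N t. (f (cupd (zh N) j t) - f (cupd z j t)) / h N"
  let ?q' = "\<lambda>N t. (cpartial j f (cupd (zh N) j t) - cpartial j f (cupd z j t)) / h N"
  let ?g = "\<lambda>t. cpartial i f (cupd z j t)"
  have diff: "(?q N has_field_derivative ?q' N t) (at t)" if "norm t < r" for N t
    by (intro DERIV_cdivide DERIV_diff slice_has_derivative[OF f] that zh z)
  have cont: "continuous_on (cball 0 s) (?q N) \<and>
      (\<forall>t\<in>ball 0 s. (?q N has_field_derivative ?q' N t) (at t))" for N
  proof
    show "continuous_on (cball 0 s) (?q N)"
      using diff[of _ N] s(2) by (intro DERIV_continuous_on[where D = "?q' N"])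
        (meson has_field_derivative_at_within mem_cball_0 le_less_trans)
  qed (use diff s(2) in auto)
  \<comment> \<open>The constant of \<open>linear_approx_bound\<close> in the \<open>i\<close>-th
    variable does not depend on \<open>t\<close>. Dividing by \<open>h N\<close> leaves an error
    proportional to \<open>norm (h N)\<close>, uniformly on the disc.\<close>
  have ulim: "uniform_limit (cball 0 s) ?q ?g sequentially"
  proof (rule metric_uniform_limit_imp_uniform_limit)
    show "uniform_limit (cball 0 s) (\<lambda>N t. complex_of_real ((2 * B / d ^ 2) * norm (h N))) (\<lambda>_. 0) sequentially"
    proof (rule uniform_limitI)
      fix e :: real assume "e > 0"
      have "(\<lambda>N. (2 * B / d ^ 2) * norm (h N)) \<longlonglongrightarrow> (2 * B / d ^ 2) * norm (0 :: complex)"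
        by (intro tendsto_intros h_lim)
      then have "(\<lambda>N. complex_of_real ((2 * B / d ^ 2) * norm (h N))) \<longlonglongrightarrow> of_real ((2 * B / d ^ 2) * norm (0 :: complex))"
        by (rule tendsto_of_real)
      then have "\<forall>\<^sub>F N in sequentially. dist (complex_of_real ((2 * B / d ^ 2) * norm (h N))) 0 < e"
        using tendstoD[OF _ \<open>e > 0\<close>] by fastforce
      then show "\<forall>\<^sub>F N in sequentially. \<forall>x\<in>cball 0 s. dist (complex_of_real ((2 * B / d ^ 2) * norm (h N))) (0::complex) < e"
        by (rule eventually_mono) simp
    qed
    show "\<forall>\<^sub>F N in sequentially. \<forall>t\<in>cball 0 s. dist (?q N t) (?g t) \<le>
        dist (complex_of_real ((2 * B / d ^ 2) * norm (h N))) 0"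
    proof (intro always_eventually allI ballI)
      fix N t assume "t \<in> cball (0 :: complex) s"
      then have t: "norm t \<le> s" by simp
      let ?z = "cupd z j t"
      have zr: "?z \<in> polydisc r" using t s z by (intro cupd_in_polydisc) auto
      have zs: "?z \<in> polydisc s'"
        using t s d polydisc_mono[of s s'] by (intro cupd_in_polydisc) (auto simp: s'_def)
      have zi: "norm (z $ i) < s" by (rule polydisc_nth[OF s(3)])
      have "norm (f (cupd ?z i (z $ i + h N)) - f (cupd ?z i (z $ i)) -
          h N * deriv (\<lambda>t. f (cupd ?z i t)) (z $ i)) \<le> (2 * B / d ^ 2) * norm (h N) ^ 2"
      proof (rule linear_approx_bound)
        show "(\<lambda>t. f (cupd ?z i t)) holomorphic_on ball 0 s'"
          by (rule holomorphic_on_subset[OF sep_holo_slice[OF f zr]]) (use s' in auto)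
        show "norm (f (cupd ?z i t')) \<le> B" if "norm t' < s'" for t'
          by (intro B(2) cupd_in_polydisc zs that)
      qed (use zi d hd in \<open>auto simp: s'_def\<close>)
      moreover have "cupd ?z i (z $ i + h N) = cupd (zh N) j t"
        unfolding zh_def by (rule cupd_commute) (use \<open>i \<noteq> j\<close> in auto)
      moreover have "cupd ?z i (z $ i) = ?z"
        using cupd_self[of ?z i] \<open>i \<noteq> j\<close> by simp
      moreover have "deriv (\<lambda>t. f (cupd ?z i t)) (z $ i) = ?g t"
        using \<open>i \<noteq> j\<close> by (simp add: cpartial_cupd)
      ultimately have *: "norm (f (cupd (zh N) j t) - f ?z - h N * ?g t) \<le> (2 * B / d ^ 2) * norm (h N) ^ 2"
        by metis
      have "?q N t - ?g t = (f (cupd (zh N) j t) - f ?z - h N * ?g t) / h N"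
        using h0[of N] by (simp add: divide_simps)
      then have "dist (?q N t) (?g t) = norm (f (cupd (zh N) j t) - f ?z - h N * ?g t) / norm (h N)"
        by (simp add: dist_norm norm_divide)
      also have "\<dots> \<le> (2 * B / d ^ 2) * norm (h N) ^ 2 / norm (h N)"
        by (rule divide_right_mono[OF *]) simp
      also have "\<dots> = (2 * B / d ^ 2) * norm (h N)"
        using h0[of N] by (simp add: power2_eq_square)
      also have "\<dots> = norm (complex_of_real ((2 * B / d ^ 2) * norm (h N)))"
        using B(1) by (simp add: norm_mult norm_divide norm_power)
      finally show "dist (?q N t) (?g t) \<le> dist (complex_of_real ((2 * B / d ^ 2) * norm (h N))) 0"
        by simp
    qed
  qed
  obtain g' where g': "\<And>t. t \<in> ball 0 s \<Longrightarrow> (?g has_field_derivative g' t) (at t) \<and> (\<lambda>N. ?q' N t) \<longlonglongrightarrow> g' t"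
    using has_complex_derivative_uniform_limit[OF always_eventually[OF allI, OF cont] ulim] s(1) by auto
  have "cupd (zh N) j w = cupd (cupd z j w) i (z $ i + h N)" for N
    unfolding zh_def by (rule cupd_commute) (use \<open>i \<noteq> j\<close> in auto)
  then show thesis
    using g'[of w] s(4) h_lim h0 by (intro that[of "g' w" h]) auto
qed

text \<open>In its own variable the partial derivative is the derivative of a holomorphic slice; in
  any other variable \<open>cpartial_slice_limit\<close> applies. The bounds on smaller polydiscs
  come from Cauchy's inequality.\<close>

lemma sep_holo_cpartial:
  fixes f :: "complex ^ 'm::finite \<Rightarrow> complex"
  assumes f: "sep_holo r f"
  shows "sep_holo r (cpartial i f)"
  unfolding sep_holo_def
proof (intro conjI ballI allI impI)
  fix z :: "complex ^ 'm" and j assume z: "z \<in> polydisc r"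
  show "(\<lambda>t. cpartial i f (cupd z j t)) holomorphic_on ball 0 r"
  proof (cases "i = j")
    case True
    have "(\<lambda>t. cpartial i f (cupd z j t)) = deriv (\<lambda>t. f (cupd z i t))"
      by (simp add: True cpartial_cupd fun_eq_iff)
    then show ?thesis
      using holomorphic_deriv[OF sep_holo_slice[OF f z] open_ball] by simp
  next
    case False
    show ?thesis
    proof (subst holomorphic_on_open[OF open_ball], intro ballI)
      fix w :: complex assume "w \<in> ball 0 r"
      then have "norm w < r" by simp
      from cpartial_slice_limit[OF f z this False]
      show "\<exists>D. ((\<lambda>t. cpartial i f (cupd z j t)) has_field_derivative D) (at w)" by metis
    qed
  qed
next
  fix s assume s: "s < r"
  define s' where "s' = (s + r) / 2"
  have s': "s' < r" "s < s'" using s by (simp_all add: s'_def)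
  obtain B where B: "0 \<le> B" "\<And>z. z \<in> polydisc s' \<Longrightarrow> norm (f z) \<le> B"
    using sep_holo_bound[OF f s'(1)] by blast
  have "norm (cpartial i f z) \<le> B / ((s' - s) / 2)" if z: "z \<in> polydisc s" for z
  proof -
    have zs: "z \<in> polydisc s'" and zr: "z \<in> polydisc r"
      using z polydisc_mono s' s by (metis less_imp_le subsetD)+
    have "norm ((deriv ^^ 1) (\<lambda>t. f (cupd z i t)) (z $ i)) \<le> fact 1 * B / ((s' - s) / 2) ^ 1"
    proof (rule higher_deriv_bound)
      show "(\<lambda>t. f (cupd z i t)) holomorphic_on ball 0 s'"
        by (rule holomorphic_on_subset[OF sep_holo_slice[OF f zr]]) (use s' in auto)
      show "norm (f (cupd z i t)) \<le> B" if "norm t < s'" for t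
        by (intro B(2) cupd_in_polydisc zs that)
      show "norm (z $ i) + (s' - s) / 2 < s'" using polydisc_nth[OF z, of i] s' by (simp add: field_simps)
    qed (use s' in auto)
    then show ?thesis by (simp add: cpartial_cupd)
  qed
  then show "\<exists>B. \<forall>z\<in>polydisc s. norm (cpartial i f z) \<le> B" by blast
qed

text \<open>Both sides are limits of the same difference quotients of \<open>cpartial j f\<close> in
  direction \<open>i\<close>: one by \<open>cpartial_slice_limit\<close>, the other by the
  definition of the derivative.\<close>

lemma cpartial_commute:
  fixes f :: "complex ^ 'm::finite \<Rightarrow> complex"
  assumes f: "sep_holo r f" and z: "z \<in> polydisc r"
  shows "cpartial j (cpartial i f) z = cpartial i (cpartial j f) z"
proof (cases "i = j")
  case False
  have zj: "norm (z $ j) < r" and zi: "norm (z $ i) < r" using z by (auto simp: polydisc_nth)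
  obtain D h where D: "((\<lambda>t. cpartial i f (cupd z j t)) has_field_derivative D) (at (z $ j))"
    and h: "h \<longlonglongrightarrow> 0" "\<And>N. h N \<noteq> 0"
    and lim: "(\<lambda>N. (cpartial j f (cupd z i (z $ i + h N)) - cpartial j f z) / h N) \<longlonglongrightarrow> D"
    using cpartial_slice_limit[OF f z zj False] by auto
  have "((\<lambda>t. cpartial j f (cupd z i t)) has_field_derivative cpartial i (cpartial j f) z) (at (z $ i))"
    using slice_has_derivative[OF sep_holo_cpartial[OF f] z zi, of j i] by simp
  then have "((\<lambda>t. (cpartial j f (cupd z i (z $ i + t)) - cpartial j f z) / t) \<longlongrightarrow> cpartial i (cpartial j f) z) (at 0)"
    by (simp add: DERIV_def)
  moreover have "filterlim h (at 0) sequentially"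
    using h by (simp add: filterlim_at)
  ultimately have "(\<lambda>N. (cpartial j f (cupd z i (z $ i + h N)) - cpartial j f z) / h N) \<longlonglongrightarrow> cpartial i (cpartial j f) z"
    by (rule filterlim_compose)
  with lim have "D = cpartial i (cpartial j f) z" using LIMSEQ_unique by blast
  with D show ?thesis by (simp add: cpartial_cupd DERIV_imp_deriv)
qed simp

text \<open>Along a coordinate line the complex-linear derivative is multiplication by a number, so
  slices are holomorphic. Compactness of a closed ball supplies the bounds.\<close>

lemma sep_holo_near:
  fixes F :: "complex ^ 'm::finite \<Rightarrow> complex"
  assumes "holomorphic_near F 0"
  obtains r where "0 < r" "sep_holo r F"
proof -
  obtain U where U: "open U" "0 \<in> U"
    and diff: "\<And>z. z \<in> U \<Longrightarrow> \<exists>D. (F has_derivative D) (at z) \<and> (\<forall>c h. D (c *s h) = c * D h)"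
    using assms unfolding holomorphic_near_def by blast
  obtain e where e: "0 < e" "cball 0 e \<subseteq> U"
    using U open_contains_cball by blast
  \<comment> \<open>The norm is at most the sum of the coordinate moduli, so this polydisc fits into
    the ball of radius \<open>e\<close>.\<close>
  define r where "r = e / real CARD('m)"
  have r: "0 < r" using e by (simp add: r_def)
  have sub: "(polydisc r :: (complex ^ 'm) set) \<subseteq> cball 0 e"
  proof
    fix z :: "complex ^ 'm" assume z: "z \<in> polydisc r"
    have "norm z \<le> (\<Sum>i\<in>UNIV. norm (z $ i))"
      by (simp add: norm_vec_def L2_set_le_sum)
    also have "\<dots> \<le> (\<Sum>i\<in>(UNIV :: 'm set). r)"
      using z by (intro sum_mono less_imp_le polydisc_nth)
    also have "\<dots> = e" by (simp add: r_def)
    finally show "z \<in> cball 0 e" by simp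
  qed
  have "continuous_on (cball 0 e) F"
    using diff e(2) by (meson continuous_at_imp_continuous_on has_derivative_continuous subsetD)
  then have "bounded (F ` cball 0 e)"
    by (intro compact_imp_bounded compact_continuous_image) auto
  then obtain B where B: "\<And>z. z \<in> cball 0 e \<Longrightarrow> norm (F z) \<le> B"
    unfolding bounded_iff by blast
  have "(\<lambda>t. F (cupd z i t)) holomorphic_on ball 0 r" if z: "z \<in> polydisc r" for z i
  proof (subst holomorphic_on_open[OF open_ball], intro ballI)
    fix w :: complex assume "w \<in> ball 0 r"
    then have "cupd z i w \<in> U"
      using cupd_in_polydisc[OF z, of w i] sub e(2) by auto
    then obtain D where D: "(F has_derivative D) (at (cupd z i w))" "\<And>c h. D (c *s h) = c * D h"
      using diff by blast
    have lin: "linear (axis i :: complex \<Rightarrow> complex ^ 'm)"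
      by (intro linearI) (auto simp: axis_def vec_eq_iff)
    have "cupd z i = (\<lambda>t. cupd z i 0 + axis i t)"
      by (auto simp: fun_eq_iff vec_eq_iff axis_def)
    moreover have "((\<lambda>t. cupd z i 0 + axis i t) has_derivative axis i) (at w)"
      using linear_conv_bounded_linear[THEN iffD1, OF lin]
      by (intro has_derivative_add_const[of _ _ _ "cupd z i 0", simplified add.commute[of _ "cupd z i 0"]]
          bounded_linear_imp_has_derivative)
    ultimately have "(cupd z i has_derivative axis i) (at w)" by metis
    from has_derivative_compose[OF this D(1)]
    have "((\<lambda>t. F (cupd z i t)) has_derivative (\<lambda>h. D (axis i h))) (at w)" .
    moreover have "(\<lambda>h. D (axis i h)) = (*) (D (axis i 1))"
    proof
      fix h
      have "axis i h = h *s (axis i 1 :: complex ^ 'm)" by (simp add: vec_eq_iff axis_def)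
      then show "D (axis i h) = D (axis i 1) * h" by (simp add: D(2))
    qed
    ultimately show "\<exists>f'. ((\<lambda>t. F (cupd z i t)) has_field_derivative f') (at w)"
      unfolding has_field_derivative_def by metis
  qed
  moreover have "\<exists>B. \<forall>z\<in>polydisc s. norm (F z) \<le> B" if "s < r" for s
    using B sub polydisc_mono[of s r] that by (meson less_imp_le subsetD)
  ultimately have "sep_holo r F" by (simp add: sep_holo_def)
  with r show thesis by (rule that)
qed

section \<open>Bounds for Taylor coefficients and termwise differentiation\<close>

lemma sep_holo_cpartial_pow:
  "sep_holo r f \<Longrightarrow> sep_holo r ((cpartial i ^^ k) f)"
  by (induction k) (auto intro: sep_holo_cpartial)

lemma sep_holo_foldr_cpartial:
  "sep_holo r f \<Longrightarrow> sep_holo r (foldr (\<lambda>j. cpartial (v j) ^^ a j) js f)"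
  by (induction js) (auto intro: sep_holo_cpartial_pow)

lemma cpartial_pow: "(cpartial i ^^ k) f z = (deriv ^^ k) (\<lambda>t. f (cupd z i t)) (z $ i)"
proof (induction k arbitrary: z)
  case (Suc k)
  then show ?case by (simp add: cpartial_cupd)
qed simp

text \<open>Cauchy's inequality one variable at a time, starting with the outermost derivative. Its
  variable runs through the disc of radius \<open>s'\<close>, while the variables still to be
  differentiated stay at 0; distinctness keeps the two apart.\<close>

lemma foldr_cpartial_bound:
  fixes f :: "complex ^ 'm::finite \<Rightarrow> complex"
  assumes f: "sep_holo r f" and s: "0 < s" "s < s'" "s' < r"
    and B: "\<And>z. z \<in> polydisc s' \<Longrightarrow> norm (f z) \<le> B"
    and "distinct (map v js)" "z \<in> polydisc s'" "\<And>j. j \<in> set js \<Longrightarrow> z $ v j = 0"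
  shows "norm (foldr (\<lambda>j. cpartial (v j) ^^ a j) js f z) \<le> B * (\<Prod>j\<leftarrow>js. fact (a j) / s ^ a j)"
  using assms(6-8)
proof (induction js arbitrary: z)
  case (Cons j js)
  let ?G = "foldr (\<lambda>j. cpartial (v j) ^^ a j) js f"
  let ?B = "B * (\<Prod>j\<leftarrow>js. fact (a j) / s ^ a j)"
  have G: "sep_holo r ?G" by (rule sep_holo_foldr_cpartial[OF f])
  have zr: "z \<in> polydisc r" using Cons.prems(2) polydisc_mono[of s' r] s by auto
  have "norm ((deriv ^^ a j) (\<lambda>t. ?G (cupd z (v j) t)) (z $ v j)) \<le> fact (a j) * ?B / s ^ a j"
  proof (rule higher_deriv_bound)
    show "(\<lambda>t. ?G (cupd z (v j) t)) holomorphic_on ball 0 s'"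
      by (rule holomorphic_on_subset[OF sep_holo_slice[OF G zr]]) (use s in auto)
    show "norm (?G (cupd z (v j) t)) \<le> ?B" if "norm t < s'" for t
    proof (rule Cons.IH)
      have "v i \<noteq> v j" if "i \<in> set js" for i using Cons.prems(1) that by (auto simp: image_iff)
      then show "cupd z (v j) t $ v i = 0" if "i \<in> set js" for i
        using Cons.prems(3)[of i] that by auto
    qed (use Cons.prems that cupd_in_polydisc in auto)
  qed (use s Cons.prems in auto)
  then show ?case by (simp add: cpartial_pow[where f = ?G] mult_ac)
qed (use B in simp)

text \<open>The factorials in \<open>foldr_cpartial_bound\<close> cancel against those in
  \<open>taylor_coeff\<close>, which leaves Cauchy's estimates with the supremum over a slightly
  larger polydisc.\<close>

lemma taylor_coeff_bound:
  fixes f :: "complex ^ 'm::finite \<Rightarrow> complex"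
  assumes v: "bij_betw v {..<CARD('m)} UNIV" and f: "sep_holo r f" and s: "0 < s" "s < r"
  obtains K where "0 \<le> K" "\<And>\<alpha>. norm (taylor_coeff v f \<alpha>) \<le> K / s ^ (\<Sum>i\<in>UNIV. \<alpha> i)"
proof -
  obtain s' where s': "s < s'" "s' < r" using s(2) dense by blast
  obtain B where B: "0 \<le> B" "\<And>z. z \<in> polydisc s' \<Longrightarrow> norm (f z) \<le> B"
    using sep_holo_bound[OF f s'(2)] by blast
  have "norm (taylor_coeff v f \<alpha>) \<le> B / s ^ (\<Sum>i\<in>UNIV. \<alpha> i)" for \<alpha>
  proof -
    have "norm (foldr (\<lambda>j. cpartial (v j) ^^ \<alpha> (v j)) [0..<CARD('m)] f 0) \<le>
        B * (\<Prod>j\<leftarrow>[0..<CARD('m)]. fact (\<alpha> (v j)) / s ^ \<alpha> (v j))"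
    proof (rule foldr_cpartial_bound[OF f s(1) s' B(2)])
      show "distinct (map v [0..<CARD('m)])"
        using v by (simp add: distinct_map bij_betw_def lessThan_atLeast0)
    qed (use s s' in \<open>auto simp: polydisc_def\<close>)
    also have "(\<Prod>j\<leftarrow>[0..<CARD('m)]. fact (\<alpha> (v j)) / s ^ \<alpha> (v j)) =
        (\<Prod>j<CARD('m). fact (\<alpha> (v j)) / s ^ \<alpha> (v j))"
      by (simp add: prod.distinct_set_conv_list[symmetric] lessThan_atLeast0)
    also have "\<dots> = (\<Prod>i\<in>UNIV. fact (\<alpha> i) / s ^ \<alpha> i)"
      by (rule prod.reindex_bij_betw[OF v])
    also have "\<dots> = (\<Prod>i\<in>UNIV. fact (\<alpha> i)) / s ^ (\<Sum>i\<in>UNIV. \<alpha> i)"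
      by (simp add: prod_dividef power_sum)
    finally show ?thesis
      by (simp add: taylor_coeff_def norm_divide prod_norm[symmetric] pos_divide_le_eq prod_pos mult_ac)
  qed
  with B(1) show thesis by (rule that)
qed

text \<open>Identities such as \<open>cpartial_commute\<close> hold only inside the polydisc, not as
  equations between functions; this lemma allows them to be used under further derivatives.\<close>

lemma cpartial_cong:
  fixes f g :: "complex ^ 'm::finite \<Rightarrow> complex"
  assumes "\<And>z. z \<in> polydisc r \<Longrightarrow> f z = g z" "z \<in> polydisc r"
  shows "cpartial i f z = cpartial i g z"
  unfolding cpartial_cupd
proof (rule deriv_cong_ev)
  have "\<forall>\<^sub>F t in nhds (z $ i). t \<in> ball 0 r"
    using polydisc_nth[OF assms(2), of i] by (intro eventually_nhds_in_open) auto
  then show "\<forall>\<^sub>F t in nhds (z $ i). f (cupd z i t) = g (cupd z i t)"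
    by (rule eventually_mono) (use assms in \<open>auto intro: cupd_in_polydisc\<close>)
qed simp

lemma cpartial_pow_cong:
  fixes f g :: "complex ^ 'm::finite \<Rightarrow> complex"
  assumes "\<And>z. z \<in> polydisc r \<Longrightarrow> f z = g z" "z \<in> polydisc r"
  shows "(cpartial i ^^ k) f z = (cpartial i ^^ k) g z"
  using assms(2) by (induction k arbitrary: z) (auto intro: cpartial_cong assms(1))

lemma cpartial_pow_commute:
  fixes f :: "complex ^ 'm::finite \<Rightarrow> complex"
  assumes f: "sep_holo r f" and "z \<in> polydisc r"
  shows "(cpartial j ^^ k) (cpartial i f) z = cpartial i ((cpartial j ^^ k) f) z"
  using assms(2)
proof (induction k arbitrary: z)
  case (Suc k)
  have "(cpartial j ^^ Suc k) (cpartial i f) z = cpartial j (cpartial i ((cpartial j ^^ k) f)) z"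
    using cpartial_cong[OF Suc.IH Suc.prems] by simp
  then show ?case
    using cpartial_commute[OF sep_holo_cpartial_pow[OF f] Suc.prems] by simp
qed simp

text \<open>The extra derivative is commuted outwards through the list. At position \<open>k\<close>
  it is absorbed and raises the exponent there; otherwise it emerges in front.\<close>

lemma foldr_cpartial_shift:
  fixes f :: "complex ^ 'm::finite \<Rightarrow> complex"
  assumes f: "sep_holo r f" and "distinct js" "z \<in> polydisc r"
  shows "foldr (\<lambda>j. cpartial (v j) ^^ a j) js (cpartial (v k) f) z =
    (if k \<in> set js then foldr (\<lambda>j. cpartial (v j) ^^ (if j = k then Suc (a j) else a j)) js f z
     else cpartial (v k) (foldr (\<lambda>j. cpartial (v j) ^^ a j) js f) z)"
  using assms(2,3)
proof (induction js arbitrary: z)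
  case (Cons j js)
  let ?a' = "\<lambda>j. if j = k then Suc (a j) else a j"
  let ?G = "foldr (\<lambda>j. cpartial (v j) ^^ a j) js f"
  have G: "sep_holo r ?G" by (rule sep_holo_foldr_cpartial[OF f])
  have same: "foldr (\<lambda>j. cpartial (v j) ^^ ?a' j) js f = ?G" if "k \<notin> set js"
    using that by (intro foldr_cong) auto
  have "foldr (\<lambda>j. cpartial (v j) ^^ a j) (j # js) (cpartial (v k) f) z =
      (cpartial (v j) ^^ a j) (\<lambda>z. if k \<in> set js then foldr (\<lambda>j. cpartial (v j) ^^ ?a' j) js f z
        else cpartial (v k) ?G z) z"
    using Cons.prems Cons.IH by (auto intro!: cpartial_pow_cong)
  also have "\<dots> = (if k \<in> set js then (cpartial (v j) ^^ a j) (foldr (\<lambda>j. cpartial (v j) ^^ ?a' j) js f) z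
      else (cpartial (v j) ^^ a j) (cpartial (v k) ?G) z)"
    by simp
  also have "(cpartial (v j) ^^ a j) (cpartial (v k) ?G) z = cpartial (v k) ((cpartial (v j) ^^ a j) ?G) z"
    by (rule cpartial_pow_commute[OF G Cons.prems(2)])
  finally show ?case
    using Cons.prems(1) same by auto
qed simp

text \<open>Termwise differentiation of the Taylor series. The extra derivative moves to its place
  by \<open>foldr_cpartial_shift\<close>, and the factor is the quotient of two consecutive
  factorials.\<close>

lemma taylor_coeff_cpartial:
  fixes f :: "complex ^ 'm::finite \<Rightarrow> complex"
  assumes v: "bij_betw v {..<CARD('m)} UNIV" and f: "sep_holo r f" "0 < r" and k: "k < CARD('m)"
  shows "taylor_coeff v (cpartial (v k) f) \<alpha> =
    of_nat (Suc (\<alpha> (v k))) * taylor_coeff v f (\<alpha>(v k := Suc (\<alpha> (v k))))"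
proof -
  let ?\<alpha> = "\<alpha>(v k := Suc (\<alpha> (v k)))"
  have "foldr (\<lambda>j. cpartial (v j) ^^ \<alpha> (v j)) [0..<CARD('m)] (cpartial (v k) f) 0 =
      foldr (\<lambda>j. cpartial (v j) ^^ (if j = k then Suc (\<alpha> (v j)) else \<alpha> (v j))) [0..<CARD('m)] f 0"
    using k f(2) by (subst foldr_cpartial_shift[OF f(1)]) (auto simp: polydisc_def)
  also have "\<dots> = foldr (\<lambda>j. cpartial (v j) ^^ ?\<alpha> (v j)) [0..<CARD('m)] f 0"
  proof (rule arg_cong[where f = "\<lambda>g. g 0"], rule foldr_cong)
    fix j h assume j: "j \<in> set [0..<CARD('m)]"
    then have "v j = v k \<longleftrightarrow> j = k"
      using v k by (auto simp: bij_betw_def inj_on_def)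
    then show "(cpartial (v j) ^^ (if j = k then Suc (\<alpha> (v j)) else \<alpha> (v j))) h = (cpartial (v j) ^^ ?\<alpha> (v j)) h"
      by simp
  qed auto
  finally have *: "foldr (\<lambda>j. cpartial (v j) ^^ \<alpha> (v j)) [0..<CARD('m)] (cpartial (v k) f) 0 =
      foldr (\<lambda>j. cpartial (v j) ^^ ?\<alpha> (v j)) [0..<CARD('m)] f 0" .
  have "(\<Prod>i\<in>UNIV. fact (?\<alpha> i) :: complex) = fact (Suc (\<alpha> (v k))) * (\<Prod>i\<in>UNIV - {v k}. fact (\<alpha> i))"
    by (subst prod.remove[of _ "v k"]) auto
  also have "\<dots> = of_nat (Suc (\<alpha> (v k))) * (\<Prod>i\<in>UNIV. fact (\<alpha> i))"
    by (subst (2) prod.remove[of _ "v k"]) (auto simp: algebra_simps)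
  finally show ?thesis
    unfolding taylor_coeff_def * by (simp del: of_nat_Suc fun_upd_apply)
qed

subsection \<open>Weighted norms of generalized power series\<close>

definition gps_weight :: "real \<Rightarrow> real \<Rightarrow> complex \<Rightarrow> real" where
  "gps_weight \<Theta> t \<mu> = exp (\<Theta> * \<bar>Im \<mu>\<bar> - t * Re \<mu>)"

text \<open>The cutoff \<open>M\<close> makes the sum finite for every series, so estimates can
  proceed by induction on \<open>M\<close> before any convergence is known.\<close>

definition gps_norm :: "real \<Rightarrow> real \<Rightarrow> real \<Rightarrow> gps \<Rightarrow> real" where
  "gps_norm \<Theta> t M f = (\<Sum>\<mu> | gps_nth f \<mu> \<noteq> 0 \<and> Re \<mu> \<le> M. norm (gps_nth f \<mu>) * gps_weight \<Theta> t \<mu>)"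

text \<open>Serves to replace a substitution into an infinite Taylor series by a finite sum, one
  cutoff at a time.\<close>

definition gps_eq_upto :: "real \<Rightarrow> gps \<Rightarrow> gps \<Rightarrow> bool" where
  "gps_eq_upto M f g \<longleftrightarrow> (\<forall>\<mu>. Re \<mu> \<le> M \<longrightarrow> gps_nth f \<mu> = gps_nth g \<mu>)"

text \<open>Junk value: \<open>gps_single a \<nu> = 0\<close> if \<open>\<nu>\<close> is not an admissible exponent.\<close>

lift_definition gps_single :: "complex \<Rightarrow> complex \<Rightarrow> gps" is
  "\<lambda>a \<nu> \<mu>. if \<mu> = \<nu> \<and> (\<nu> = 0 \<or> 0 < Re \<nu>) then a else 0"
proof (intro conjI allI)
  fix a \<nu> :: complex and M :: real
  show "finite {\<mu>. (if \<mu> = \<nu> \<and> (\<nu> = 0 \<or> 0 < Re \<nu>) then a else 0) \<noteq> 0 \<and> Re \<mu> \<le> M}"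
    by (rule finite_subset[of _ "{\<nu>}"]) (auto split: if_splits)
qed auto

section \<open>Calculus of the weighted norm\<close>

lemma gps_weight_pos: "0 < gps_weight \<Theta> t \<mu>"
  by (simp add: gps_weight_def)

lemma gps_weight_add:
  assumes "0 \<le> \<Theta>"
  shows "gps_weight \<Theta> t (\<mu> + \<nu>) \<le> gps_weight \<Theta> t \<mu> * gps_weight \<Theta> t \<nu>"
proof -
  have "\<Theta> * \<bar>Im \<mu> + Im \<nu>\<bar> \<le> \<Theta> * (\<bar>Im \<mu>\<bar> + \<bar>Im \<nu>\<bar>)"
    using assms by (intro mult_left_mono abs_triangle_ineq)
  then show ?thesis by (simp add: gps_weight_def flip: exp_add) (simp add: algebra_simps)
qed

lemma gps_norm_eq_sum:
  assumes "finite S" "{\<mu>. gps_nth f \<mu> \<noteq> 0 \<and> Re \<mu> \<le> M} \<subseteq> S" "\<And>\<mu>. \<mu> \<in> S \<Longrightarrow> Re \<mu> \<le> M"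
  shows "gps_norm \<Theta> t M f = (\<Sum>\<mu>\<in>S. norm (gps_nth f \<mu>) * gps_weight \<Theta> t \<mu>)"
  unfolding gps_norm_def by (rule sum.mono_neutral_left) (use assms in auto)

lemma sum_le_gps_norm:
  assumes "finite S" "\<And>\<mu>. \<mu> \<in> S \<Longrightarrow> Re \<mu> \<le> M"
  shows "(\<Sum>\<mu>\<in>S. norm (gps_nth f \<mu>) * gps_weight \<Theta> t \<mu>) \<le> gps_norm \<Theta> t M f"
proof -
  let ?T = "S \<union> {\<mu>. gps_nth f \<mu> \<noteq> 0 \<and> Re \<mu> \<le> M}"
  have "gps_norm \<Theta> t M f = (\<Sum>\<mu>\<in>?T. norm (gps_nth f \<mu>) * gps_weight \<Theta> t \<mu>)"
    using assms by (intro gps_norm_eq_sum) (auto simp: gps_nth_finite)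
  then show ?thesis
    using assms by (auto intro!: sum_mono2 simp: gps_nth_finite gps_weight_pos less_imp_le)
qed

lemma gps_norm_nonneg: "0 \<le> gps_norm \<Theta> t M f"
  unfolding gps_norm_def by (intro sum_nonneg mult_nonneg_nonneg) (auto simp: gps_weight_pos less_imp_le)

lemma gps_norm_mono: "M \<le> M' \<Longrightarrow> gps_norm \<Theta> t M f \<le> gps_norm \<Theta> t M' f"
  unfolding gps_norm_def[of \<Theta> t M] by (rule sum_le_gps_norm) (auto simp: gps_nth_finite)

lemma gps_norm_cong: "gps_eq_upto M f g \<Longrightarrow> gps_norm \<Theta> t M f = gps_norm \<Theta> t M g"
  unfolding gps_norm_def gps_eq_upto_def by (rule sum.cong) auto

lemma gps_nth_add: "gps_nth (f + g) \<mu> = gps_nth f \<mu> + gps_nth g \<mu>"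
  by (simp add: plus_gps.rep_eq)

lemma gps_nth_uminus: "gps_nth (- f) \<mu> = - gps_nth f \<mu>"
  by (simp add: uminus_gps.rep_eq)

lemma gps_nth_diff: "gps_nth (f - g) \<mu> = gps_nth f \<mu> - gps_nth g \<mu>"
  unfolding minus_gps_def gps_nth_add gps_nth_uminus by simp

lemma gps_nth_zero: "gps_nth 0 \<mu> = 0"
  by (simp add: zero_gps.rep_eq)

lemma gps_nth_sum: "gps_nth (\<Sum>a\<in>A. f a) \<mu> = (\<Sum>a\<in>A. gps_nth (f a) \<mu>)"
  by (induction A rule: infinite_finite_induct) (auto simp: gps_nth_zero gps_nth_add)

lemma gps_norm_zero: "gps_norm \<Theta> t M 0 = 0"
  by (simp add: gps_norm_def gps_nth_zero)

lemma gps_norm_add: "gps_norm \<Theta> t M (f + g) \<le> gps_norm \<Theta> t M f + gps_norm \<Theta> t M g"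
proof -
  have "gps_norm \<Theta> t M (f + g) \<le>
      (\<Sum>\<mu> | gps_nth (f + g) \<mu> \<noteq> 0 \<and> Re \<mu> \<le> M.
        norm (gps_nth f \<mu>) * gps_weight \<Theta> t \<mu> + norm (gps_nth g \<mu>) * gps_weight \<Theta> t \<mu>)"
    unfolding gps_norm_def
    by (rule sum_mono)
      (simp add: gps_nth_add norm_triangle_ineq gps_weight_pos flip: distrib_right)
  also have "\<dots> \<le> gps_norm \<Theta> t M f + gps_norm \<Theta> t M g"
    unfolding sum.distrib by (intro add_mono sum_le_gps_norm) (auto simp: gps_nth_finite)
  finally show ?thesis .
qed

lemma gps_norm_uminus: "gps_norm \<Theta> t M (- f) = gps_norm \<Theta> t M f"
  by (simp add: gps_norm_def gps_nth_uminus)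

lemma gps_norm_sum: "gps_norm \<Theta> t M (\<Sum>a\<in>A. f a) \<le> (\<Sum>a\<in>A. gps_norm \<Theta> t M (f a))"
  by (induction A rule: infinite_finite_induct)
    (auto simp: gps_norm_zero intro: order_trans[OF gps_norm_add])

text \<open>If all exponents of \<open>g\<close> have real part at least \<open>e\<close>, an
  exponent of the product up to \<open>M\<close> uses exponents of \<open>f\<close> only up to
  \<open>M - e\<close>, and likewise with the roles exchanged. This gain in the cutoff drives the
  final induction.\<close>

lemma gps_norm_mult:
  assumes "0 \<le> \<Theta>" "gps_ge d f" "gps_ge e g"
  shows "gps_norm \<Theta> t M (f * g) \<le> gps_norm \<Theta> t (M - e) f * gps_norm \<Theta> t (M - d) g"
proof -
  let ?w = "gps_weight \<Theta> t"
  define A where "A = {a. gps_nth f a \<noteq> 0 \<and> Re a \<le> M - e}"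
  define S where "S = {\<mu>. gps_nth (f * g) \<mu> \<noteq> 0 \<and> Re \<mu> \<le> M}"
  have fin: "finite A" "finite S" by (simp_all add: A_def S_def gps_nth_finite)
  have "gps_nth (f * g) \<mu> = (\<Sum>a\<in>A. gps_nth f a * gps_nth g (\<mu> - a))" if "\<mu> \<in> S" for \<mu>
    unfolding times_gps.rep_eq
  proof (rule sum.mono_neutral_left)
    show "{a. gps_nth f a \<noteq> 0 \<and> gps_nth g (\<mu> - a) \<noteq> 0} \<subseteq> A"
      using assms(3) that by (force simp: A_def S_def gps_ge_def)
  qed (use fin in auto)
  then have "gps_norm \<Theta> t M (f * g) = (\<Sum>\<mu>\<in>S. norm (\<Sum>a\<in>A. gps_nth f a * gps_nth g (\<mu> - a)) * ?w \<mu>)"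
    by (simp add: gps_norm_def S_def)
  also have "\<dots> \<le> (\<Sum>\<mu>\<in>S. \<Sum>a\<in>A. (norm (gps_nth f a) * ?w a) * (norm (gps_nth g (\<mu> - a)) * ?w (\<mu> - a)))"
  proof (rule sum_mono)
    fix \<mu> assume "\<mu> \<in> S"
    have "norm (\<Sum>a\<in>A. gps_nth f a * gps_nth g (\<mu> - a)) * ?w \<mu>
        \<le> (\<Sum>a\<in>A. norm (gps_nth f a * gps_nth g (\<mu> - a))) * ?w \<mu>"
      by (intro mult_right_mono norm_sum) (simp add: gps_weight_pos less_imp_le)
    also have "\<dots> = (\<Sum>a\<in>A. norm (gps_nth f a) * norm (gps_nth g (\<mu> - a)) * ?w (a + (\<mu> - a)))"
      by (simp add: sum_distrib_right norm_mult)
    also have "\<dots> \<le> (\<Sum>a\<in>A. norm (gps_nth f a) * norm (gps_nth g (\<mu> - a)) * (?w a * ?w (\<mu> - a)))"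
      by (intro sum_mono mult_left_mono gps_weight_add assms(1)) auto
    finally show "norm (\<Sum>a\<in>A. gps_nth f a * gps_nth g (\<mu> - a)) * ?w \<mu> \<le>
        (\<Sum>a\<in>A. (norm (gps_nth f a) * ?w a) * (norm (gps_nth g (\<mu> - a)) * ?w (\<mu> - a)))"
      by (simp add: mult_ac)
  qed
  also have "\<dots> = (\<Sum>a\<in>A. (norm (gps_nth f a) * ?w a) * (\<Sum>\<mu>\<in>S. norm (gps_nth g (\<mu> - a)) * ?w (\<mu> - a)))"
    by (subst sum.swap) (simp add: sum_distrib_left)
  also have "\<dots> \<le> (\<Sum>a\<in>A. (norm (gps_nth f a) * ?w a) * gps_norm \<Theta> t (M - d) g)"
  proof (intro sum_mono mult_left_mono)
    fix a assume "a \<in> A"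
    then have "d \<le> Re a" using assms(2) by (auto simp: A_def gps_ge_def)
    have "(\<Sum>\<mu>\<in>S. norm (gps_nth g (\<mu> - a)) * ?w (\<mu> - a)) =
        (\<Sum>\<mu>\<in>(\<lambda>\<mu>. \<mu> - a) ` S. norm (gps_nth g \<mu>) * ?w \<mu>)"
      by (simp add: sum.reindex inj_on_def)
    also have "\<dots> \<le> gps_norm \<Theta> t (M - d) g"
      using fin \<open>d \<le> Re a\<close> by (intro sum_le_gps_norm) (auto simp: S_def)
    finally show "(\<Sum>\<mu>\<in>S. norm (gps_nth g (\<mu> - a)) * ?w (\<mu> - a)) \<le> gps_norm \<Theta> t (M - d) g" .
  qed (simp add: gps_weight_pos less_imp_le)
  also have "\<dots> = gps_norm \<Theta> t (M - e) f * gps_norm \<Theta> t (M - d) g"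
    by (simp add: gps_norm_def A_def sum_distrib_right)
  finally show ?thesis .
qed

lemma gps_ge_0: "gps_ge 0 f"
  using gps_nth_Re_nonneg by (auto simp: gps_ge_def)

lemma gps_norm_mult_le:
  assumes "0 \<le> \<Theta>" "gps_norm \<Theta> t M f \<le> a" "gps_norm \<Theta> t M g \<le> b"
  shows "gps_norm \<Theta> t M (f * g) \<le> a * b"
  using gps_norm_mult[OF assms(1) gps_ge_0 gps_ge_0, of t M f g] assms(2,3)
  by (auto intro: order_trans mult_mono gps_norm_nonneg order_trans[OF gps_norm_nonneg])

lemma gps_norm_single: "gps_norm \<Theta> t M (gps_single a \<nu>) \<le> norm a * gps_weight \<Theta> t \<nu>"
proof -
  have "{\<mu>. gps_nth (gps_single a \<nu>) \<mu> \<noteq> 0 \<and> Re \<mu> \<le> M} \<subseteq> {\<nu>}"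
    by (auto simp: gps_single.rep_eq split: if_splits)
  then have "gps_norm \<Theta> t M (gps_single a \<nu>) \<le> (\<Sum>\<mu>\<in>{\<nu>}. norm (gps_nth (gps_single a \<nu>) \<mu>) * gps_weight \<Theta> t \<mu>)"
    unfolding gps_norm_def by (intro sum_mono2) (auto simp: gps_weight_pos less_imp_le)
  also have "\<dots> \<le> norm a * gps_weight \<Theta> t \<nu>"
    by (auto simp: gps_single.rep_eq gps_weight_pos less_imp_le)
  finally show ?thesis .
qed

lemma gps_norm_const: "gps_norm \<Theta> t M (gps_single a 0) \<le> norm a"
  using gps_norm_single[of \<Theta> t M a 0] by (simp add: gps_weight_def)

lemma gps_single_one: "gps_single 1 0 = 1"
  by (rule gps_eqI) (simp add: gps_single.rep_eq one_gps.rep_eq)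

lemma gps_nth_single_times:
  assumes "\<nu> = 0 \<or> 0 < Re \<nu>"
  shows "gps_nth (gps_single a \<nu> * f) \<mu> = a * gps_nth f (\<mu> - \<nu>)"
proof -
  have "gps_nth (gps_single a \<nu> * f) \<mu> = (\<Sum>b\<in>{\<nu>}. gps_nth (gps_single a \<nu>) b * gps_nth f (\<mu> - b))"
    by (rule gps_nth_times) (auto simp: gps_single.rep_eq split: if_splits)
  then show ?thesis using assms by (simp add: gps_single.rep_eq)
qed

text \<open>Raising \<open>t\<close> means shrinking the radius \<open>exp (- t)\<close>: the weight
  of every exponent with real part at least \<open>d\<close> drops at least by the stated
  factor.\<close>

lemma gps_norm_decay:
  assumes "gps_ge d f" "t0 \<le> t"
  shows "gps_norm \<Theta> t M f \<le> exp (- (t - t0) * d) * gps_norm \<Theta> t0 M f"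
  unfolding gps_norm_def sum_distrib_left
proof (rule sum_mono)
  fix \<mu> assume "\<mu> \<in> {\<mu>. gps_nth f \<mu> \<noteq> 0 \<and> Re \<mu> \<le> M}"
  then have "d \<le> Re \<mu>" using assms by (auto simp: gps_ge_def)
  then have "(t - t0) * d \<le> (t - t0) * Re \<mu>" using assms by (intro mult_left_mono) auto
  then have "gps_weight \<Theta> t \<mu> \<le> exp (- (t - t0) * d) * gps_weight \<Theta> t0 \<mu>"
    by (simp add: gps_weight_def flip: exp_add) (simp add: algebra_simps)
  from mult_left_mono[OF this norm_ge_zero[of "gps_nth f \<mu>"]]
  show "norm (gps_nth f \<mu>) * gps_weight \<Theta> t \<mu> \<le>
      exp (- (t - t0) * d) * (norm (gps_nth f \<mu>) * gps_weight \<Theta> t0 \<mu>)"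
    by (simp add: mult_ac)
qed

text \<open>Exponents of \<open>g\<close> have nonnegative real part, so the product up to
  \<open>M\<close> does not see \<open>f\<close> beyond \<open>M\<close>.\<close>

lemma gps_eq_upto_mult: "gps_eq_upto M f f' \<Longrightarrow> gps_eq_upto M (f * g) (f' * g)"
  unfolding gps_eq_upto_def
proof (intro allI impI)
  fix \<mu> assume eq: "\<forall>\<mu>. Re \<mu> \<le> M \<longrightarrow> gps_nth f \<mu> = gps_nth f' \<mu>" and \<mu>: "Re \<mu> \<le> M"
  let ?A = "{a. gps_nth g a \<noteq> 0 \<and> Re a \<le> Re \<mu>}"
  have "gps_nth (h * g) \<mu> = (\<Sum>a\<in>?A. gps_nth h (\<mu> - a) * gps_nth g a)" for h
    by (rule gps_nth_times') (auto simp: gps_nth_finite)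
  moreover have "gps_nth f (\<mu> - a) = gps_nth f' (\<mu> - a)" if "a \<in> ?A" for a
    using eq \<mu> gps_nth_Re_nonneg[of g a] that by auto
  ultimately show "gps_nth (f * g) \<mu> = gps_nth (f' * g) \<mu>" by simp
qed

lemma gps_ge_mono: "gps_ge d f \<Longrightarrow> e \<le> d \<Longrightarrow> gps_ge e f"
  unfolding gps_ge_def using order_trans by blast

lemma gps_ge_add: "gps_ge d f \<Longrightarrow> gps_ge d g \<Longrightarrow> gps_ge d (f + g)"
  unfolding gps_ge_def gps_nth_add by (metis add.right_neutral)

lemma gps_ge_uminus: "gps_ge d f \<Longrightarrow> gps_ge d (- f)"
  by (simp add: gps_ge_def gps_nth_uminus)

lemma gps_ge_diff: "gps_ge d f \<Longrightarrow> gps_ge d g \<Longrightarrow> gps_ge d (f - g)"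
  unfolding minus_gps_def by (intro gps_ge_add gps_ge_uminus)

lemma gps_ge_zero: "gps_ge d 0"
  by (simp add: gps_ge_def gps_nth_zero)

lemma gps_ge_sum: "(\<And>a. a \<in> A \<Longrightarrow> gps_ge d (f a)) \<Longrightarrow> gps_ge d (\<Sum>a\<in>A. f a)"
  by (induction A rule: infinite_finite_induct) (auto simp: gps_ge_zero gps_ge_add)

lemma gps_ge_mult_left: "gps_ge d f \<Longrightarrow> gps_ge d (g * f)"
  using gps_ge_times[OF gps_ge_0, of d f g] by simp

lemma gps_ge_upto:
  assumes "\<And>M. \<exists>g. gps_eq_upto M f g \<and> gps_ge d g"
  shows "gps_ge d f"
  using assms unfolding gps_ge_def gps_eq_upto_def by (metis order_refl)

section \<open>Monomials and their expansion to first order\<close>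

lemma multiindex_induct:
  fixes v :: "nat \<Rightarrow> 'm::finite"
  assumes v: "bij_betw v {..<CARD('m)} UNIV"
    and zero: "P (\<lambda>_. 0)"
    and step: "\<And>\<alpha> k. k < CARD('m) \<Longrightarrow> P \<alpha> \<Longrightarrow> P (\<alpha>(v k := Suc (\<alpha> (v k))))"
  shows "P \<alpha>"
proof (induction "\<Sum>i\<in>UNIV. \<alpha> i" arbitrary: \<alpha>)
  case 0
  then have "\<alpha> = (\<lambda>_. 0)" by auto
  then show ?case using zero by simp
next
  case (Suc N)
  then obtain i where i: "\<alpha> i \<noteq> 0" by (metis sum.neutral nat.distinct(1))
  obtain k where k: "k < CARD('m)" "v k = i"
    using v by (metis UNIV_I bij_betw_iff_bijections lessThan_iff)
  let ?\<beta> = "\<alpha>(i := \<alpha> i - 1)"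
  have "(\<Sum>j\<in>UNIV. \<alpha> j) = Suc (\<Sum>j\<in>UNIV. ?\<beta> j)"
    using i by (simp add: sum.remove[of UNIV i])
  with Suc have "P ?\<beta>" by simp
  from step[OF k(1) this] show ?case using i k(2) by (simp add: fun_upd_idem)
qed

lemma multiindex_sum_Suc:
  fixes \<alpha> :: "'m::finite \<Rightarrow> nat"
  shows "(\<Sum>j\<in>UNIV. (\<alpha>(i := Suc (\<alpha> i))) j) = Suc (\<Sum>j\<in>UNIV. \<alpha> j)"
  by (simp add: sum.remove[of UNIV i])

lemma gps_monomial_Suc:
  fixes v :: "nat \<Rightarrow> 'm::finite"
  assumes v: "bij_betw v {..<CARD('m)} UNIV" and k: "k < CARD('m)"
  shows "gps_monomial v Y (\<alpha>(v k := Suc (\<alpha> (v k)))) = Y k * gps_monomial v Y \<alpha>"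
proof -
  have "v j = v k \<longleftrightarrow> j = k" if "j < CARD('m)" for j
    using v k that by (auto simp: bij_betw_def inj_on_def)
  then have "(\<Prod>j\<in>{..<CARD('m)} - {k}. Y j ^ (\<alpha>(v k := Suc (\<alpha> (v k)))) (v j)) =
      (\<Prod>j\<in>{..<CARD('m)} - {k}. Y j ^ \<alpha> (v j))"
    by (intro prod.cong) auto
  then show ?thesis
    using k by (simp add: gps_monomial_def prod.remove[of "{..<CARD('m)}" k] mult.assoc del: fun_upd_apply)
      (simp add: mult.assoc)
qed

lemma gps_monomial_0: "gps_monomial v Y (\<lambda>_. 0) = 1"
  by (simp add: gps_monomial_def)

text \<open>The part of the monomial in \<open>P + \<Psi>\<close> that is linear in
  \<open>\<Psi>\<close>. Where \<open>\<alpha> (v k) = 0\<close>, the natural subtraction is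
  harmless because the factor \<open>of_nat (\<alpha> (v k))\<close> vanishes.\<close>

definition gps_monomial_lin :: "(nat \<Rightarrow> 'm::finite) \<Rightarrow> (nat \<Rightarrow> gps) \<Rightarrow> (nat \<Rightarrow> gps) \<Rightarrow> ('m \<Rightarrow> nat) \<Rightarrow> gps" where
  "gps_monomial_lin v P \<Psi> \<alpha> =
     (\<Sum>k<CARD('m). of_nat (\<alpha> (v k)) * gps_monomial v P (\<alpha>(v k := \<alpha> (v k) - 1)) * \<Psi> k)"

definition gps_monomial_diff :: "(nat \<Rightarrow> 'm::finite) \<Rightarrow> (nat \<Rightarrow> gps) \<Rightarrow> (nat \<Rightarrow> gps) \<Rightarrow> ('m \<Rightarrow> nat) \<Rightarrow> gps" where
  "gps_monomial_diff v P \<Psi> \<alpha> = gps_monomial v (\<lambda>k. P k + \<Psi> k) \<alpha> - gps_monomial v P \<alpha>"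

definition gps_monomial_rem :: "(nat \<Rightarrow> 'm::finite) \<Rightarrow> (nat \<Rightarrow> gps) \<Rightarrow> (nat \<Rightarrow> gps) \<Rightarrow> ('m \<Rightarrow> nat) \<Rightarrow> gps" where
  "gps_monomial_rem v P \<Psi> \<alpha> = gps_monomial_diff v P \<Psi> \<alpha> - gps_monomial_lin v P \<Psi> \<alpha>"

text \<open>The product rule for one additional factor. Together with the recursions for the
  difference and the remainder it permits induction on multi-indices in place of a multinomial
  expansion.\<close>

lemma gps_monomial_lin_Suc:
  fixes v :: "nat \<Rightarrow> 'm::finite"
  assumes v: "bij_betw v {..<CARD('m)} UNIV" and i: "i < CARD('m)"
  shows "gps_monomial_lin v P \<Psi> (\<alpha>(v i := Suc (\<alpha> (v i)))) =
    P i * gps_monomial_lin v P \<Psi> \<alpha> + \<Psi> i * gps_monomial v P \<alpha>"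
proof -
  let ?\<alpha> = "\<alpha>(v i := Suc (\<alpha> (v i)))"
  let ?T = "\<lambda>\<alpha> k. of_nat (\<alpha> (v k)) * gps_monomial v P (\<alpha>(v k := \<alpha> (v k) - 1)) * \<Psi> k"
  have vi: "v k = v i \<longleftrightarrow> k = i" if "k < CARD('m)" for k
    using v i that by (auto simp: bij_betw_def inj_on_def)
  have other: "?T ?\<alpha> k = P i * ?T \<alpha> k" if "k \<in> {..<CARD('m)} - {i}" for k
  proof -
    have ne: "v k \<noteq> v i" using vi[of k] that by auto
    let ?\<beta> = "\<alpha>(v k := \<alpha> (v k) - 1)"
    have "?\<alpha>(v k := ?\<alpha> (v k) - 1) = ?\<beta>(v i := Suc (?\<beta> (v i)))"
      using ne by (auto simp: fun_eq_iff)
    then have "gps_monomial v P (?\<alpha>(v k := ?\<alpha> (v k) - 1)) = P i * gps_monomial v P ?\<beta>"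
      using gps_monomial_Suc[OF v i, of P ?\<beta>] by metis
    moreover have "?\<alpha> (v k) = \<alpha> (v k)" using ne by simp
    ultimately show ?thesis by (simp only: mult_ac)
  qed
  \<comment> \<open>For \<open>\<alpha> (v i) = 0\<close> both sides vanish; otherwise
    \<open>gps_monomial_Suc\<close> undoes the natural subtraction.\<close>
  have "of_nat (\<alpha> (v i)) * gps_monomial v P \<alpha> =
      of_nat (\<alpha> (v i)) * (P i * gps_monomial v P (\<alpha>(v i := \<alpha> (v i) - 1)))"
  proof (cases "\<alpha> (v i)")
    case (Suc a)
    then have "\<alpha> = (\<alpha>(v i := a))(v i := Suc ((\<alpha>(v i := a)) (v i)))" by (auto simp: fun_eq_iff)
    then have "gps_monomial v P \<alpha> = P i * gps_monomial v P (\<alpha>(v i := a))"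
      using gps_monomial_Suc[OF v i, of P "\<alpha>(v i := a)"] by metis
    then show ?thesis using Suc by simp
  qed simp
  then have same: "?T ?\<alpha> i = P i * ?T \<alpha> i + \<Psi> i * gps_monomial v P \<alpha>"
    by (simp add: algebra_simps fun_upd_idem)
  have "gps_monomial_lin v P \<Psi> ?\<alpha> = ?T ?\<alpha> i + (\<Sum>k\<in>{..<CARD('m)} - {i}. ?T ?\<alpha> k)"
    unfolding gps_monomial_lin_def using i by (intro sum.remove) auto
  also have "(\<Sum>k\<in>{..<CARD('m)} - {i}. ?T ?\<alpha> k) = (\<Sum>k\<in>{..<CARD('m)} - {i}. P i * ?T \<alpha> k)"
    by (rule sum.cong[OF refl other])
  also have "?T ?\<alpha> i + \<dots> = P i * (?T \<alpha> i + (\<Sum>k\<in>{..<CARD('m)} - {i}. ?T \<alpha> k)) + \<Psi> i * gps_monomial v P \<alpha>"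
    unfolding same by (simp add: distrib_left sum_distrib_left algebra_simps)
  also have "?T \<alpha> i + (\<Sum>k\<in>{..<CARD('m)} - {i}. ?T \<alpha> k) = gps_monomial_lin v P \<Psi> \<alpha>"
    unfolding gps_monomial_lin_def using i by (intro sum.remove[symmetric]) auto
  finally show ?thesis .
qed

lemma gps_monomial_diff_Suc:
  fixes v :: "nat \<Rightarrow> 'm::finite"
  assumes "bij_betw v {..<CARD('m)} UNIV" "i < CARD('m)"
  shows "gps_monomial_diff v P \<Psi> (\<alpha>(v i := Suc (\<alpha> (v i)))) =
    (P i + \<Psi> i) * gps_monomial_diff v P \<Psi> \<alpha> + \<Psi> i * gps_monomial v P \<alpha>"
  unfolding gps_monomial_diff_def gps_monomial_Suc[OF assms] by (simp add: algebra_simps)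

lemma gps_monomial_rem_Suc:
  fixes v :: "nat \<Rightarrow> 'm::finite"
  assumes "bij_betw v {..<CARD('m)} UNIV" "i < CARD('m)"
  shows "gps_monomial_rem v P \<Psi> (\<alpha>(v i := Suc (\<alpha> (v i)))) =
    P i * gps_monomial_rem v P \<Psi> \<alpha> + \<Psi> i * gps_monomial_diff v P \<Psi> \<alpha>"
  unfolding gps_monomial_rem_def gps_monomial_diff_Suc[OF assms] gps_monomial_lin_Suc[OF assms]
  by (simp add: algebra_simps)

lemma gps_monomial_diff_0: "gps_monomial_diff v P \<Psi> (\<lambda>_. 0) = 0"
  by (simp add: gps_monomial_diff_def gps_monomial_0)

lemma gps_monomial_rem_0: "gps_monomial_rem v P \<Psi> (\<lambda>_. 0) = 0"
  by (simp add: gps_monomial_rem_def gps_monomial_diff_0 gps_monomial_lin_def)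

lemma gps_ge_monomial_diff:
  fixes v :: "nat \<Rightarrow> 'm::finite"
  assumes v: "bij_betw v {..<CARD('m)} UNIV" and \<Psi>: "\<And>k. k < CARD('m) \<Longrightarrow> gps_ge m (\<Psi> k)"
  shows "gps_ge m (gps_monomial_diff v P \<Psi> \<alpha>)"
proof (induction \<alpha> rule: multiindex_induct[OF v])
  case (2 \<alpha> k)
  then show ?case
    unfolding gps_monomial_diff_Suc[OF v 2(1)]
    by (subst mult.commute[of "\<Psi> k"]) (intro gps_ge_add gps_ge_mult_left \<Psi>)
qed (simp add: gps_monomial_diff_0 gps_ge_zero)

text \<open>In the recursion every new contribution is \<open>\<Psi> k\<close> times a difference of
  order at least \<open>m\<close>, so the orders add up.\<close>

lemma gps_ge_monomial_rem:
  fixes v :: "nat \<Rightarrow> 'm::finite"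
  assumes v: "bij_betw v {..<CARD('m)} UNIV" and \<Psi>: "\<And>k. k < CARD('m) \<Longrightarrow> gps_ge m (\<Psi> k)"
  shows "gps_ge (m + m) (gps_monomial_rem v P \<Psi> \<alpha>)"
proof (induction \<alpha> rule: multiindex_induct[OF v])
  case (2 \<alpha> k)
  then show ?case
    unfolding gps_monomial_rem_Suc[OF v 2(1)]
    by (intro gps_ge_add gps_ge_mult_left gps_ge_times gps_ge_monomial_diff[OF v] \<Psi>)
qed (simp add: gps_monomial_rem_0 gps_ge_zero)

lemma gps_ge_monomial:
  fixes v :: "nat \<Rightarrow> 'm::finite"
  assumes v: "bij_betw v {..<CARD('m)} UNIV" and Y: "\<And>k. k < CARD('m) \<Longrightarrow> gps_ge d (Y k)"
  shows "gps_ge (real (\<Sum>i\<in>UNIV. \<alpha> i) * d) (gps_monomial v Y \<alpha>)"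
proof (induction \<alpha> rule: multiindex_induct[OF v])
  case (2 \<alpha> k)
  have "gps_ge (d + real (\<Sum>i\<in>UNIV. \<alpha> i) * d) (Y k * gps_monomial v Y \<alpha>)"
    by (intro gps_ge_times Y 2)
  then show ?case
    unfolding gps_monomial_Suc[OF v 2(1)] multiindex_sum_Suc by (simp add: algebra_simps)
qed (simp add: gps_monomial_0 gps_ge_one)

lemma gps_norm_one: "gps_norm \<Theta> t M 1 \<le> 1"
  using gps_norm_const[of \<Theta> t M 1] by (simp add: gps_single_one)

lemma gps_norm_monomial:
  fixes v :: "nat \<Rightarrow> 'm::finite"
  assumes v: "bij_betw v {..<CARD('m)} UNIV" and \<Theta>: "0 \<le> \<Theta>"
    and Y: "\<And>k. k < CARD('m) \<Longrightarrow> gps_norm \<Theta> t M (Y k) \<le> q"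
  shows "gps_norm \<Theta> t M (gps_monomial v Y \<alpha>) \<le> q ^ (\<Sum>i\<in>UNIV. \<alpha> i)"
proof (induction \<alpha> rule: multiindex_induct[OF v])
  case (2 \<alpha> k)
  from gps_norm_mult_le[OF \<Theta> Y[OF 2(1)] 2(2)] show ?case
    unfolding gps_monomial_Suc[OF v 2(1)] multiindex_sum_Suc by simp
qed (simp add: gps_monomial_0 gps_norm_one)

text \<open>The mean value bound \<open>N * s * q ^ (N - 1)\<close> for total degree
  \<open>N\<close>, written with \<open>s / q\<close> and \<open>q ^ N\<close> so that no exponent
  \<open>N - 1\<close> occurs.\<close>

lemma gps_norm_monomial_diff:
  fixes v :: "nat \<Rightarrow> 'm::finite"
  assumes v: "bij_betw v {..<CARD('m)} UNIV" and \<Theta>: "0 \<le> \<Theta>" and q: "p + s \<le> q" "0 \<le> s" "0 < q"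
    and P: "\<And>k. k < CARD('m) \<Longrightarrow> gps_norm \<Theta> t M (P k) \<le> p"
    and \<Psi>: "\<And>k. k < CARD('m) \<Longrightarrow> gps_norm \<Theta> t M (\<Psi> k) \<le> s"
  shows "gps_norm \<Theta> t M (gps_monomial_diff v P \<Psi> \<alpha>) \<le>
    real (\<Sum>i\<in>UNIV. \<alpha> i) * (s / q) * q ^ (\<Sum>i\<in>UNIV. \<alpha> i)"
proof (induction \<alpha> rule: multiindex_induct[OF v])
  case (2 \<alpha> k)
  let ?N = "\<Sum>i\<in>UNIV. \<alpha> i"
  have Pq: "gps_norm \<Theta> t M (P j) \<le> q" if "j < CARD('m)" for j using P[OF that] q by linarith
  have PPsi: "gps_norm \<Theta> t M (P k + \<Psi> k) \<le> q"
    using gps_norm_add[of \<Theta> t M "P k" "\<Psi> k"] P[OF 2(1)] \<Psi>[OF 2(1)] q by linarith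
  have "gps_norm \<Theta> t M ((P k + \<Psi> k) * gps_monomial_diff v P \<Psi> \<alpha> + \<Psi> k * gps_monomial v P \<alpha>) \<le>
      q * (real ?N * (s / q) * q ^ ?N) + s * q ^ ?N"
    by (intro order_trans[OF gps_norm_add] add_mono gps_norm_mult_le \<Theta> PPsi 2 \<Psi> gps_norm_monomial v Pq)
  also have "\<dots> = real (Suc ?N) * (s / q) * q ^ Suc ?N"
    using q by (simp add: field_simps)
  finally show ?case
    unfolding gps_monomial_diff_Suc[OF v 2(1)] multiindex_sum_Suc .
qed (simp add: gps_monomial_diff_0 gps_norm_zero)

text \<open>The quadratic analogue. Each term carries two factors \<open>\<Psi>\<close> of order at
  least \<open>m\<close>, hence only the norms of \<open>\<Psi>\<close> up to \<open>M - m\<close>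
  enter, although the remainder is measured up to \<open>M\<close>.\<close>

lemma gps_norm_monomial_rem:
  fixes v :: "nat \<Rightarrow> 'm::finite"
  assumes v: "bij_betw v {..<CARD('m)} UNIV" and \<Theta>: "0 \<le> \<Theta>" and q: "p + s \<le> q" "0 \<le> s" "0 < q"
    and P: "\<And>k. k < CARD('m) \<Longrightarrow> gps_norm \<Theta> t M (P k) \<le> p"
    and m: "0 \<le> m" "\<And>k. k < CARD('m) \<Longrightarrow> gps_ge m (\<Psi> k)"
    and \<Psi>: "\<And>k. k < CARD('m) \<Longrightarrow> gps_norm \<Theta> t (M - m) (\<Psi> k) \<le> s"
  shows "gps_norm \<Theta> t M (gps_monomial_rem v P \<Psi> \<alpha>) \<le>
    (real (\<Sum>i\<in>UNIV. \<alpha> i))\<^sup>2 * (s / q)\<^sup>2 * q ^ (\<Sum>i\<in>UNIV. \<alpha> i)"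
proof (induction \<alpha> rule: multiindex_induct[OF v])
  case (2 \<alpha> k)
  let ?N = "\<Sum>i\<in>UNIV. \<alpha> i"
  have Pq: "gps_norm \<Theta> t M (P k) \<le> q" using P[OF 2(1)] q by linarith
  have P': "gps_norm \<Theta> t (M - m) (P j) \<le> p" if "j < CARD('m)" for j
    using gps_norm_mono[of "M - m" M \<Theta> t "P j"] P[OF that] m(1) by linarith
  have D: "gps_norm \<Theta> t (M - m) (gps_monomial_diff v P \<Psi> \<alpha>) \<le> real ?N * (s / q) * q ^ ?N"
    by (rule gps_norm_monomial_diff[OF v \<Theta> q P' \<Psi>])
  have "gps_norm \<Theta> t M (\<Psi> k * gps_monomial_diff v P \<Psi> \<alpha>) \<le>
      gps_norm \<Theta> t (M - m) (\<Psi> k) * gps_norm \<Theta> t (M - m) (gps_monomial_diff v P \<Psi> \<alpha>)"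
    by (intro gps_norm_mult \<Theta> m(2) 2 gps_ge_monomial_diff v)
  also have "\<dots> \<le> s * (real ?N * (s / q) * q ^ ?N)"
    by (intro mult_mono \<Psi> D 2 q gps_norm_nonneg)
  finally have \<Psi>D: "gps_norm \<Theta> t M (\<Psi> k * gps_monomial_diff v P \<Psi> \<alpha>) \<le>
      s * (real ?N * (s / q) * q ^ ?N)" .
  have "gps_norm \<Theta> t M (P k * gps_monomial_rem v P \<Psi> \<alpha> + \<Psi> k * gps_monomial_diff v P \<Psi> \<alpha>) \<le>
      q * ((real ?N)\<^sup>2 * (s / q)\<^sup>2 * q ^ ?N) + s * (real ?N * (s / q) * q ^ ?N)"
    by (rule order_trans[OF gps_norm_add add_mono[OF gps_norm_mult_le[OF \<Theta> Pq 2(2)] \<Psi>D]])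
  also have "\<dots> = ((real ?N)\<^sup>2 + real ?N) * ((s / q)\<^sup>2 * q ^ Suc ?N)"
    using q by (simp add: field_simps power2_eq_square)
  also have "\<dots> \<le> (real (Suc ?N))\<^sup>2 * ((s / q)\<^sup>2 * q ^ Suc ?N)"
    using q by (intro mult_right_mono) (auto simp: power2_eq_square algebra_simps simp del: of_nat_sum)
  finally show ?case
    unfolding gps_monomial_rem_Suc[OF v 2(1)] multiindex_sum_Suc by (simp only: mult_ac)
qed (simp add: gps_monomial_rem_0 gps_norm_zero)

subsection \<open>First-order expansion of the substitution\<close>

definition multiindices :: "nat \<Rightarrow> ('m::finite \<Rightarrow> nat) set" where
  "multiindices K = {\<alpha>. (\<Sum>i\<in>UNIV. \<alpha> i) \<le> K}"

lemma multiindices_subset: "multiindices K \<subseteq> PiE UNIV (\<lambda>_. {..K})"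
proof
  fix \<alpha> :: "'a \<Rightarrow> nat" assume \<alpha>: "\<alpha> \<in> multiindices K"
  have "\<alpha> i \<le> (\<Sum>i\<in>UNIV. \<alpha> i)" for i by (intro member_le_sum) auto
  then show "\<alpha> \<in> PiE UNIV (\<lambda>_. {..K})"
    using \<alpha> by (auto simp: multiindices_def PiE_UNIV_domain intro: order_trans)
qed

lemma finite_multiindices: "finite (multiindices K)"
  by (rule finite_subset[OF multiindices_subset]) (intro finite_PiE, auto)

text \<open>Enlarging the simplex of multi-indices to a box turns the sum into a product of
  geometric sums, each at most 2, whatever \<open>K\<close> is.\<close>

lemma sum_half_powers_multiindices:
  "(\<Sum>\<alpha>\<in>(multiindices K :: ('m::finite \<Rightarrow> nat) set). (1/2 :: real) ^ (\<Sum>i\<in>UNIV. \<alpha> i)) \<le> 2 ^ CARD('m)"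
proof -
  have geo: "(\<Sum>k\<in>{..K}. (1/2 :: real) ^ k) \<le> 2"
  proof -
    have "(\<Sum>k\<in>{..K}. (1/2 :: real) ^ k) = 2 - (1/2) ^ K" by (induction K) simp_all
    then show ?thesis by simp
  qed
  have "(\<Sum>\<alpha>\<in>(multiindices K :: ('m \<Rightarrow> nat) set). (1/2 :: real) ^ (\<Sum>i\<in>UNIV. \<alpha> i)) \<le>
      (\<Sum>\<alpha>\<in>PiE (UNIV :: 'm set) (\<lambda>_. {..K}). (1/2 :: real) ^ (\<Sum>i\<in>UNIV. \<alpha> i))"
    by (rule sum_mono2[OF finite_PiE multiindices_subset]) auto
  also have "\<dots> = (\<Prod>i\<in>(UNIV :: 'm set). \<Sum>k\<in>{..K}. (1/2 :: real) ^ k)"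
    by (subst prod_sum_PiE) (auto simp: power_sum)
  also have "\<dots> \<le> (\<Prod>i\<in>(UNIV :: 'm set). 2)"
    using geo by (intro prod_mono) (auto intro: sum_nonneg)
  finally show ?thesis by simp
qed

lemma gps_single_add: "gps_single (a + b) \<nu> = gps_single a \<nu> + gps_single b \<nu>"
  by (rule gps_eqI) (auto simp: gps_single.rep_eq gps_nth_add)

lemma gps_single_mult: "gps_single (a * b) 0 = gps_single a 0 * gps_single b 0"
  by (rule gps_eqI) (simp add: gps_nth_single_times, simp add: gps_single.rep_eq)

lemma gps_single_zero: "gps_single 0 \<nu> = 0"
  by (rule gps_eqI) (simp add: gps_single.rep_eq gps_nth_zero)

lemma gps_single_of_nat: "gps_single (of_nat k) 0 = of_nat k"
  by (induction k) (simp_all add: gps_single_zero gps_single_add gps_single_one)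

text \<open>Substitution into the Taylor polynomial of degree \<open>K\<close>. Being a finite sum
  in the ring, it is open to ring algebra; \<open>gps_single a 0\<close> embeds the
  constants.\<close>

definition gps_subst_trunc :: "nat \<Rightarrow> (nat \<Rightarrow> 'm::finite) \<Rightarrow> (complex ^ 'm \<Rightarrow> complex) \<Rightarrow> (nat \<Rightarrow> gps) \<Rightarrow> gps" where
  "gps_subst_trunc K v F Y = (\<Sum>\<alpha>\<in>multiindices K. gps_single (taylor_coeff v F \<alpha>) 0 * gps_monomial v Y \<alpha>)"

text \<open>A monomial of total degree \<open>N\<close> has order at least \<open>N * d\<close>, so
  degrees above \<open>K\<close> contribute only exponents with real part above
  \<open>M\<close>.\<close>

lemma gps_subst_trunc_upto:
  fixes v :: "nat \<Rightarrow> 'm::finite"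
  assumes v: "bij_betw v {..<CARD('m)} UNIV" and Y: "\<And>k. k < CARD('m) \<Longrightarrow> gps_ge d (Y k)"
    and d: "0 < d" "M < real (Suc K) * d"
  shows "gps_eq_upto M (gps_subst v F Y) (gps_subst_trunc K v F Y)"
  unfolding gps_eq_upto_def
proof (intro allI impI)
  fix \<mu> assume \<mu>: "Re \<mu> \<le> M"
  have Y0: "gps_nth (Y j) 0 = 0" if "j < CARD('m)" for j
    using Y[OF that] d by (auto simp: gps_ge_def)
  have sub: "{\<alpha>. gps_nth (gps_monomial v Y \<alpha>) \<mu> \<noteq> 0} \<subseteq> multiindices K"
  proof
    fix \<alpha> assume "\<alpha> \<in> {\<alpha>. gps_nth (gps_monomial v Y \<alpha>) \<mu> \<noteq> 0}"
    then have "real (\<Sum>i\<in>UNIV. \<alpha> i) * d \<le> Re \<mu>"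
      using gps_ge_monomial[OF v Y, where \<alpha> = \<alpha>] by (auto simp: gps_ge_def)
    with \<mu> d have "real (\<Sum>i\<in>UNIV. \<alpha> i) * d < real (Suc K) * d" by linarith
    then have "real (\<Sum>i\<in>UNIV. \<alpha> i) < real (Suc K)" using d(1) mult_less_cancel_right_pos by blast
    then show "\<alpha> \<in> multiindices K" unfolding multiindices_def by (simp only: of_nat_less_iff mem_Collect_eq less_Suc_eq_le)
  qed
  show "gps_nth (gps_subst v F Y) \<mu> = gps_nth (gps_subst_trunc K v F Y) \<mu>"
    unfolding gps_subst_trunc_def gps_nth_sum 
    by (subst gps_nth_subst[OF v Y0], assumption, rule sum.mono_neutral_cong_left[OF finite_multiindices sub]) (auto simp: gps_nth_single_times)
qed

text \<open>Arguments of norm at most \<open>s / 2\<close> against Cauchy's estimates leave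
  \<open>K\<close> times half powers, whose sum is bounded independently of the degree of truncation
  and of \<open>M\<close>.\<close>

lemma gps_norm_subst:
  fixes v :: "nat \<Rightarrow> 'm::finite"
  assumes v: "bij_betw v {..<CARD('m)} UNIV" and \<Theta>: "0 \<le> \<Theta>"
    and Y: "\<And>k. k < CARD('m) \<Longrightarrow> gps_ge d (Y k)" and d: "0 < d"
    and K: "0 \<le> K" "\<And>\<alpha>. norm (taylor_coeff v F \<alpha>) \<le> K / s ^ (\<Sum>i\<in>UNIV. \<alpha> i)" and s: "0 < s"
    and norm: "\<And>k. k < CARD('m) \<Longrightarrow> gps_norm \<Theta> t M (Y k) \<le> s / 2"
  shows "gps_norm \<Theta> t M (gps_subst v F Y) \<le> K * 2 ^ CARD('m)"
proof -
  obtain N :: nat where "M / d < real N" using reals_Archimedean2 by blast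
  then have "M < real (Suc N) * d" using d by (simp add: pos_divide_less_eq algebra_simps)
  from gps_subst_trunc_upto[OF v Y d this]
  have "gps_norm \<Theta> t M (gps_subst v F Y) = gps_norm \<Theta> t M (gps_subst_trunc N v F Y)"
    by (rule gps_norm_cong)
  also have "\<dots> \<le> (\<Sum>\<alpha>\<in>(multiindices N :: ('m \<Rightarrow> nat) set). K * (1/2) ^ (\<Sum>i\<in>UNIV. \<alpha> i))"
    unfolding gps_subst_trunc_def
  proof (intro order_trans[OF gps_norm_sum] sum_mono)
    fix \<alpha> :: "'m \<Rightarrow> nat"
    let ?N = "\<Sum>i\<in>UNIV. \<alpha> i"
    have "gps_norm \<Theta> t M (gps_single (taylor_coeff v F \<alpha>) 0 * gps_monomial v Y \<alpha>) \<le> K / s ^ ?N * (s / 2) ^ ?N"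
      by (intro gps_norm_mult_le \<Theta> order_trans[OF gps_norm_const K(2)] gps_norm_monomial v norm)
    also have "\<dots> = K * (1/2) ^ ?N"
      using s by (simp add: power_divide)
    finally show "gps_norm \<Theta> t M (gps_single (taylor_coeff v F \<alpha>) 0 * gps_monomial v Y \<alpha>) \<le> K * (1/2) ^ ?N" .
  qed
  also have "\<dots> \<le> K * 2 ^ CARD('m)"
    unfolding sum_distrib_left[symmetric] by (intro mult_left_mono sum_half_powers_multiindices K(1))
  finally show ?thesis .
qed

text \<open>Serves to carry the leading behaviour of the partial derivatives from the full series
  over to its truncation.\<close>

lemma gps_ge_subst_diff:
  fixes v :: "nat \<Rightarrow> 'm::finite"
  assumes v: "bij_betw v {..<CARD('m)} UNIV"
    and d: "0 < d" "\<And>k. k < CARD('m) \<Longrightarrow> gps_ge d (P k)" "\<And>k. k < CARD('m) \<Longrightarrow> gps_ge d (\<Psi> k)"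
    and m: "\<And>k. k < CARD('m) \<Longrightarrow> gps_ge m (\<Psi> k)"
  shows "gps_ge m (gps_subst v F (\<lambda>k. P k + \<Psi> k) - gps_subst v F P)"
proof (rule gps_ge_upto)
  fix M
  obtain N :: nat where "M / d < real N" using reals_Archimedean2 by blast
  then have N: "M < real (Suc N) * d" using d by (simp add: pos_divide_less_eq algebra_simps)
  let ?Y = "\<lambda>k. P k + \<Psi> k"
  have "gps_eq_upto M (gps_subst v F ?Y) (gps_subst_trunc N v F ?Y)"
    by (rule gps_subst_trunc_upto[OF v gps_ge_add d(1) N]) (use d in auto)
  moreover have "gps_eq_upto M (gps_subst v F P) (gps_subst_trunc N v F P)"
    by (rule gps_subst_trunc_upto[OF v d(2) d(1) N])
  ultimately have "gps_eq_upto M (gps_subst v F ?Y - gps_subst v F P)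
      (gps_subst_trunc N v F ?Y - gps_subst_trunc N v F P)"
    by (simp add: gps_eq_upto_def gps_nth_diff)
  moreover have "gps_subst_trunc N v F ?Y - gps_subst_trunc N v F P =
      (\<Sum>\<alpha>\<in>multiindices N. gps_single (taylor_coeff v F \<alpha>) 0 * gps_monomial_diff v P \<Psi> \<alpha>)"
    by (simp add: gps_subst_trunc_def gps_monomial_diff_def sum_subtractf right_diff_distrib)
  moreover have "gps_ge m (\<Sum>\<alpha>\<in>multiindices N. gps_single (taylor_coeff v F \<alpha>) 0 * gps_monomial_diff v P \<Psi> \<alpha>)"
    by (intro gps_ge_sum gps_ge_mult_left gps_ge_monomial_diff[OF v m])
  ultimately show "\<exists>g. gps_eq_upto M (gps_subst v F ?Y - gps_subst v F P) g \<and> gps_ge m g"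
    by auto
qed

text \<open>Terms with \<open>\<alpha> i = 0\<close> vanish, and lowering \<open>\<alpha> i\<close>
  by one maps the others bijectively onto the multi-indices of degree at most \<open>K\<close>. This
  matches linear parts of monomials with Taylor coefficients of partial derivatives.\<close>

lemma sum_multiindices_shift:
  fixes c :: "('m::finite \<Rightarrow> nat) \<Rightarrow> 'a::comm_ring_1"
  shows "(\<Sum>\<alpha>\<in>multiindices (Suc K). c \<alpha> * (of_nat (\<alpha> i) * w (\<alpha>(i := \<alpha> i - 1)))) =
    (\<Sum>\<beta>\<in>multiindices K. of_nat (Suc (\<beta> i)) * c (\<beta>(i := Suc (\<beta> i))) * w \<beta>)"
proof -
  have "(\<Sum>\<alpha>\<in>multiindices (Suc K). c \<alpha> * (of_nat (\<alpha> i) * w (\<alpha>(i := \<alpha> i - 1)))) =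
      (\<Sum>\<alpha>\<in>{\<alpha> \<in> multiindices (Suc K). \<alpha> i \<noteq> 0}. c \<alpha> * (of_nat (\<alpha> i) * w (\<alpha>(i := \<alpha> i - 1))))"
    by (rule sum.mono_neutral_right) (auto simp: finite_multiindices)
  also have "\<dots> = (\<Sum>\<beta>\<in>multiindices K. of_nat (Suc (\<beta> i)) * c (\<beta>(i := Suc (\<beta> i))) * w \<beta>)"
  proof (rule sum.reindex_bij_witness[of _ "\<lambda>\<beta>. \<beta>(i := Suc (\<beta> i))" "\<lambda>\<alpha>. \<alpha>(i := \<alpha> i - 1)"])
    fix \<alpha> assume \<alpha>: "\<alpha> \<in> {\<alpha> \<in> multiindices (Suc K). \<alpha> i \<noteq> 0}"
    let ?\<beta> = "\<alpha>(i := \<alpha> i - 1)"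
    have eq: "?\<beta>(i := Suc (?\<beta> i)) = \<alpha>" using \<alpha> by (auto simp: fun_eq_iff)
    show "?\<beta>(i := Suc (?\<beta> i)) = \<alpha>" by (rule eq)
    show "?\<beta> \<in> multiindices K"
      using multiindex_sum_Suc[of ?\<beta> i] \<alpha> unfolding eq by (simp add: multiindices_def)
    show "of_nat (Suc (?\<beta> i)) * c (?\<beta>(i := Suc (?\<beta> i))) * w ?\<beta> = c \<alpha> * (of_nat (\<alpha> i) * w ?\<beta>)"
      unfolding eq using \<alpha> by (simp add: mult_ac)
  next
    fix \<beta> :: "'m \<Rightarrow> nat" assume \<beta>: "\<beta> \<in> multiindices K"
    show "(\<beta>(i := Suc (\<beta> i)))(i := (\<beta>(i := Suc (\<beta> i))) i - 1) = \<beta>" by simp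
    show "\<beta>(i := Suc (\<beta> i)) \<in> {\<alpha> \<in> multiindices (Suc K). \<alpha> i \<noteq> 0}"
      using multiindex_sum_Suc[of \<beta> i] \<beta> by (simp add: multiindices_def)
  qed
  finally show ?thesis .
qed

definition gps_subst_rem :: "(nat \<Rightarrow> 'm::finite) \<Rightarrow> (complex ^ 'm \<Rightarrow> complex) \<Rightarrow> (nat \<Rightarrow> gps) \<Rightarrow> (nat \<Rightarrow> gps) \<Rightarrow> gps" where
  "gps_subst_rem v F P \<Psi> = gps_subst v F (\<lambda>k. P k + \<Psi> k) - gps_subst v F P -
     (\<Sum>k<CARD('m). gps_subst v (cpartial (v k) F) P * \<Psi> k)"

text \<open>\<open>F\<close> is truncated at degree \<open>Suc N\<close> and its derivatives at
  degree \<open>N\<close>, so that termwise differentiation is exact and the finite sums combine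
  into monomial remainders.\<close>

lemma gps_subst_rem_upto:
  fixes v :: "nat \<Rightarrow> 'm::finite" and F :: "complex ^ 'm \<Rightarrow> complex"
  assumes v: "bij_betw v {..<CARD('m)} UNIV" and F: "sep_holo r F" "0 < r"
    and d: "0 < d" "\<And>k. k < CARD('m) \<Longrightarrow> gps_ge d (P k)" "\<And>k. k < CARD('m) \<Longrightarrow> gps_ge d (\<Psi> k)"
  obtains K where "gps_eq_upto M (gps_subst_rem v F P \<Psi>)
    (\<Sum>\<alpha>\<in>multiindices K. gps_single (taylor_coeff v F \<alpha>) 0 * gps_monomial_rem v P \<Psi> \<alpha>)"
proof -
  obtain N :: nat where "M / d < real N" using reals_Archimedean2 by blast
  then have N: "M < real (Suc N) * d" "M < real (Suc (Suc N)) * d"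
    using d(1) by (auto simp: pos_divide_less_eq algebra_simps)
  let ?Y = "\<lambda>k. P k + \<Psi> k" and ?F = "\<lambda>k. cpartial (v k) F"
  let ?a = "\<lambda>\<alpha>. gps_single (taylor_coeff v F \<alpha>) 0"
  have Y: "gps_eq_upto M (gps_subst v F ?Y) (gps_subst_trunc (Suc N) v F ?Y)"
    by (rule gps_subst_trunc_upto[OF v gps_ge_add d(1) N(2)]) (use d in auto)
  have P: "gps_eq_upto M (gps_subst v F P) (gps_subst_trunc (Suc N) v F P)"
    by (rule gps_subst_trunc_upto[OF v d(2) d(1) N(2)])
  have F': "gps_eq_upto M (gps_subst v (?F k) P * \<Psi> k) (gps_subst_trunc N v (?F k) P * \<Psi> k)" for k
    by (intro gps_eq_upto_mult gps_subst_trunc_upto[OF v d(2) d(1) N(1)])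
  have "gps_eq_upto M (gps_subst_rem v F P \<Psi>)
      (gps_subst_trunc (Suc N) v F ?Y - gps_subst_trunc (Suc N) v F P -
        (\<Sum>k<CARD('m). gps_subst_trunc N v (?F k) P * \<Psi> k))"
    using Y P F' by (simp add: gps_eq_upto_def gps_subst_rem_def gps_nth_diff gps_nth_sum)
  moreover have "(\<Sum>k<CARD('m). gps_subst_trunc N v (?F k) P * \<Psi> k) =
      (\<Sum>\<alpha>\<in>multiindices (Suc N). ?a \<alpha> * gps_monomial_lin v P \<Psi> \<alpha>)"
  proof -
    have "gps_subst_trunc N v (?F k) P =
        (\<Sum>\<alpha>\<in>multiindices (Suc N). ?a \<alpha> * (of_nat (\<alpha> (v k)) * gps_monomial v P (\<alpha>(v k := \<alpha> (v k) - 1))))"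
      if "k < CARD('m)" for k
      unfolding sum_multiindices_shift[where c = ?a and i = "v k" and w = "gps_monomial v P"] gps_subst_trunc_def
      by (rule sum.cong[OF refl])
        (simp only: taylor_coeff_cpartial[OF v F that] gps_single_mult gps_single_of_nat)
    then have "(\<Sum>k<CARD('m). gps_subst_trunc N v (?F k) P * \<Psi> k) =
        (\<Sum>k<CARD('m). \<Sum>\<alpha>\<in>multiindices (Suc N).
          ?a \<alpha> * (of_nat (\<alpha> (v k)) * gps_monomial v P (\<alpha>(v k := \<alpha> (v k) - 1)) * \<Psi> k))"
      by (simp add: sum_distrib_right mult.assoc)
    also have "\<dots> = (\<Sum>\<alpha>\<in>multiindices (Suc N). \<Sum>k<CARD('m).
          ?a \<alpha> * (of_nat (\<alpha> (v k)) * gps_monomial v P (\<alpha>(v k := \<alpha> (v k) - 1)) * \<Psi> k))"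
      by (rule sum.swap)
    finally show ?thesis by (simp add: gps_monomial_lin_def sum_distrib_left)
  qed
  ultimately have "gps_eq_upto M (gps_subst_rem v F P \<Psi>)
      (\<Sum>\<alpha>\<in>multiindices (Suc N). ?a \<alpha> * gps_monomial_rem v P \<Psi> \<alpha>)"
    by (simp add: gps_subst_trunc_def gps_monomial_rem_def gps_monomial_diff_def
        sum_subtractf right_diff_distrib)
  then show thesis by (rule that)
qed

lemma gps_ge_subst_rem:
  fixes v :: "nat \<Rightarrow> 'm::finite" and F :: "complex ^ 'm \<Rightarrow> complex"
  assumes v: "bij_betw v {..<CARD('m)} UNIV" and F: "sep_holo r F" "0 < r"
    and d: "0 < d" "\<And>k. k < CARD('m) \<Longrightarrow> gps_ge d (P k)" "\<And>k. k < CARD('m) \<Longrightarrow> gps_ge d (\<Psi> k)"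
    and m: "\<And>k. k < CARD('m) \<Longrightarrow> gps_ge m (\<Psi> k)"
  shows "gps_ge (m + m) (gps_subst_rem v F P \<Psi>)"
proof (rule gps_ge_upto)
  fix M
  obtain K where K: "gps_eq_upto M (gps_subst_rem v F P \<Psi>)
    (\<Sum>\<alpha>\<in>multiindices K. gps_single (taylor_coeff v F \<alpha>) 0 * gps_monomial_rem v P \<Psi> \<alpha>)"
    using gps_subst_rem_upto[OF v F d] .
  show "\<exists>g. gps_eq_upto M (gps_subst_rem v F P \<Psi>) g \<and> gps_ge (m + m) g"
    by (rule exI, rule conjI[OF K]) (intro gps_ge_sum gps_ge_mult_left gps_ge_monomial_rem[OF v m])
qed

lemma square_le_four_times_power2: "(real n)\<^sup>2 \<le> 4 * 2 ^ n"
proof -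
  have "n\<^sup>2 \<le> 4 * 2 ^ n"
  proof (induction n)
    case (Suc n)
    have "2 * n + 1 \<le> 4 * 2 ^ n" using less_exp[of n] by linarith
    with Suc show ?case by (simp add: power2_eq_square)
  qed simp
  then have "real (n\<^sup>2) \<le> real (4 * 2 ^ n)" by (rule of_nat_mono)
  then show ?thesis by simp
qed

text \<open>Bounding the arguments by \<open>s / 4\<close> instead of \<open>s / 2\<close> leaves
  powers of 1/4. Half of this decay absorbs the squared degree from
  \<open>gps_norm_monomial_rem\<close>, and the remaining half powers are summed as before.\<close>

lemma gps_norm_subst_rem:
  fixes v :: "nat \<Rightarrow> 'm::finite" and F :: "complex ^ 'm \<Rightarrow> complex"
  assumes v: "bij_betw v {..<CARD('m)} UNIV" and F: "sep_holo r F" "0 < r" and \<Theta>: "0 \<le> \<Theta>"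
    and d: "0 < d" "\<And>k. k < CARD('m) \<Longrightarrow> gps_ge d (P k)" "\<And>k. k < CARD('m) \<Longrightarrow> gps_ge d (\<Psi> k)"
    and m: "0 \<le> m" "\<And>k. k < CARD('m) \<Longrightarrow> gps_ge m (\<Psi> k)"
    and K: "0 \<le> K" "\<And>\<alpha>. norm (taylor_coeff v F \<alpha>) \<le> K / s ^ (\<Sum>i\<in>UNIV. \<alpha> i)" and s: "0 < s"
    and u: "p + u \<le> s / 4" "0 \<le> u"
    and P: "\<And>k. k < CARD('m) \<Longrightarrow> gps_norm \<Theta> t M (P k) \<le> p"
    and \<Psi>: "\<And>k. k < CARD('m) \<Longrightarrow> gps_norm \<Theta> t (M - m) (\<Psi> k) \<le> u"
  shows "gps_norm \<Theta> t M (gps_subst_rem v F P \<Psi>) \<le> 64 * K * 2 ^ CARD('m) / s\<^sup>2 * u\<^sup>2"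
proof -
  obtain N where N: "gps_eq_upto M (gps_subst_rem v F P \<Psi>)
    (\<Sum>\<alpha>\<in>multiindices N. gps_single (taylor_coeff v F \<alpha>) 0 * gps_monomial_rem v P \<Psi> \<alpha>)"
    using gps_subst_rem_upto[OF v F d] .
  have "gps_norm \<Theta> t M (gps_subst_rem v F P \<Psi>) \<le>
      (\<Sum>\<alpha>\<in>(multiindices N :: ('m \<Rightarrow> nat) set). (64 * K / s\<^sup>2 * u\<^sup>2) * (1/2) ^ (\<Sum>i\<in>UNIV. \<alpha> i))"
    unfolding gps_norm_cong[OF N]
  proof (intro order_trans[OF gps_norm_sum] sum_mono)
    fix \<alpha> :: "'m \<Rightarrow> nat"
    let ?N = "\<Sum>i\<in>UNIV. \<alpha> i"
    have "gps_norm \<Theta> t M (gps_single (taylor_coeff v F \<alpha>) 0 * gps_monomial_rem v P \<Psi> \<alpha>) \<le>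
        K / s ^ ?N * ((real ?N)\<^sup>2 * (u / (s / 4))\<^sup>2 * (s / 4) ^ ?N)"
      using s by (intro gps_norm_mult_le \<Theta> order_trans[OF gps_norm_const K(2)]
          gps_norm_monomial_rem[OF v \<Theta> u _ P m \<Psi>]) auto
    also have "\<dots> = (16 * K / s\<^sup>2 * u\<^sup>2) * ((real ?N)\<^sup>2 / 4 ^ ?N)"
      using s by (simp add: power_divide field_simps del: of_nat_sum)
    also have "\<dots> \<le> (16 * K / s\<^sup>2 * u\<^sup>2) * (4 * 2 ^ ?N / 4 ^ ?N)"
      using K(1) by (intro mult_left_mono divide_right_mono square_le_four_times_power2) auto
    also have "4 * 2 ^ ?N / 4 ^ ?N = 4 * (1/2 :: real) ^ ?N"
      by (simp add: power_divide field_simps flip: power_mult_distrib)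
    finally show "gps_norm \<Theta> t M (gps_single (taylor_coeff v F \<alpha>) 0 * gps_monomial_rem v P \<Psi> \<alpha>) \<le>
        (64 * K / s\<^sup>2 * u\<^sup>2) * (1/2) ^ ?N" by simp
  qed
  also have "\<dots> \<le> (64 * K / s\<^sup>2 * u\<^sup>2) * 2 ^ CARD('m)"
    unfolding sum_distrib_left[symmetric] using K(1) by (intro mult_left_mono sum_half_powers_multiindices) auto
  finally show ?thesis by (simp add: field_simps)
qed

subsection \<open>The majorant estimate\<close>

text \<open>Since \<open>norm z \<ge> Re z\<close>, the choice of \<open>m\<close> forces the
  lower-order terms to be at most half of the leading one. As also \<open>norm z > 1\<close>, the
  power \<open>n\<close> dominates all smaller powers.\<close>

lemma symbol_lower_bound:
  fixes A :: "nat \<Rightarrow> complex"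
  assumes "A n \<noteq> 0"
  obtains C m where "0 \<le> C"
    "\<And>z j. m < Re z \<Longrightarrow> j \<le> n \<Longrightarrow> norm z ^ j \<le> C * norm (\<Sum>j\<le>n. A j * z ^ j)"
proof -
  define S where "S = (\<Sum>j<n. norm (A j))"
  define m where "m = max 1 (2 * S / norm (A n))"
  have An: "0 < norm (A n)" using assms by simp
  have "norm z ^ j \<le> 2 / norm (A n) * norm (\<Sum>j\<le>n. A j * z ^ j)" if z: "m < Re z" and j: "j \<le> n" for z j
  proof -
    define R where "R = norm z"
    have R: "1 < R" "2 * S / norm (A n) < R"
      using z complex_Re_le_cmod[of z] by (auto simp: m_def R_def)
    let ?L = "\<Sum>j<n. A j * z ^ j"
    \<comment> \<open>Multiplying by \<open>R\<close> avoids the exponent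
      \<open>n - 1\<close>.\<close>
    have "norm ?L * R \<le> (\<Sum>j<n. norm (A j) * R ^ j) * R"
      using R by (intro mult_right_mono order_trans[OF norm_sum]) (auto simp: norm_mult norm_power R_def)
    also have "\<dots> = (\<Sum>j<n. norm (A j) * R ^ Suc j)"
      by (simp add: sum_distrib_left sum_distrib_right mult_ac)
    also have "\<dots> \<le> (\<Sum>j<n. norm (A j) * R ^ n)"
      using R by (intro sum_mono mult_left_mono power_increasing) auto
    also have "\<dots> = S * R ^ n" by (simp add: S_def sum_distrib_right)
    also have "\<dots> \<le> (norm (A n) * R / 2) * R ^ n"
      using R An by (intro mult_right_mono) (auto simp: field_simps)
    finally have "norm ?L * R \<le> (norm (A n) * R ^ n / 2) * R" by (simp add: mult_ac)
    then have L: "norm ?L \<le> norm (A n) * R ^ n / 2" using R by simp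
    have "norm (A n * z ^ n) \<le> norm ((\<Sum>j\<le>n. A j * z ^ j)) + norm ?L"
      by (simp add: lessThan_Suc_atMost[symmetric]) (metis add.commute add_diff_cancel_right' norm_triangle_ineq4)
    then have "norm (A n) * R ^ n \<le> 2 * norm (\<Sum>j\<le>n. A j * z ^ j)"
      using L by (simp add: norm_mult norm_power R_def)
    then have "R ^ n \<le> 2 / norm (A n) * norm (\<Sum>j\<le>n. A j * z ^ j)"
      using An by (simp add: field_simps)
    moreover have "R ^ j \<le> R ^ n" using R j by (intro power_increasing) auto
    ultimately show ?thesis by (simp add: R_def)
  qed
  then show thesis using An by (intro that[of "2 / norm (A n)" m]) auto
qed

text \<open>Only finitely many exponents have real part at most \<open>Re \<nu> + 1\<close>, so the
  strict inequality leaves a uniform gap.\<close>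

lemma gps_small_o_gap:
  assumes "gps_small_o \<nu> f"
  shows "\<exists>e>0. gps_ge (Re \<nu> + e) f"
proof -
  define S where "S = insert (Re \<nu> + 1) (Re ` {\<mu>. gps_nth f \<mu> \<noteq> 0 \<and> Re \<mu> \<le> Re \<nu> + 1})"
  have S: "finite S" "S \<noteq> {}" by (simp_all add: S_def gps_nth_finite)
  have "Re \<nu> < Min S"
    using S assms by (subst Min_gr_iff) (auto simp: S_def gps_small_o_def)
  moreover have "Min S \<le> Re \<mu>" if "gps_nth f \<mu> \<noteq> 0" for \<mu>
  proof (cases "Re \<mu> \<le> Re \<nu> + 1")
    case True
    then show ?thesis using S that by (intro Min_le) (auto simp: S_def)
  next
    case False
    moreover have "Min S \<le> Re \<nu> + 1" using S by (intro Min_le) (auto simp: S_def)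
    ultimately show ?thesis by simp
  qed
  ultimately show ?thesis
    by (intro exI[of _ "Min S - Re \<nu>"]) (auto simp: gps_ge_def)
qed

lemma gps_nth_delta_pow: "gps_nth ((gps_delta ^^ j) f) \<mu> = \<mu> ^ j * gps_nth f \<mu>"
  by (induction j) (auto simp: gps_delta.rep_eq)

lift_definition gps_trunc :: "real \<Rightarrow> gps \<Rightarrow> gps" is "\<lambda>m f \<mu>. if Re \<mu> \<le> m then f \<mu> else 0"
proof (intro conjI allI)
  fix m M and f :: "complex \<Rightarrow> complex"
  assume f: "(\<forall>\<mu>. f \<mu> \<noteq> 0 \<longrightarrow> \<mu> = 0 \<or> 0 < Re \<mu>) \<and> (\<forall>M. finite {\<mu>. f \<mu> \<noteq> 0 \<and> Re \<mu> \<le> M})"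
  show "finite {\<mu>. (if Re \<mu> \<le> m then f \<mu> else 0) \<noteq> 0 \<and> Re \<mu> \<le> M}"
    by (rule finite_subset[of _ "{\<mu>. f \<mu> \<noteq> 0 \<and> Re \<mu> \<le> M}"]) (use f in auto)
  show "(if Re \<mu> \<le> m then f \<mu> else 0) \<noteq> 0 \<longrightarrow> \<mu> = 0 \<or> 0 < Re \<mu>" for \<mu>
    using f by auto
qed

lemma gps_norm_le_of_finite_support:
  "(\<And>\<mu>. gps_nth f \<mu> \<noteq> 0 \<Longrightarrow> Re \<mu> \<le> b) \<Longrightarrow> gps_norm \<Theta> t M f \<le> gps_norm \<Theta> t b f"
  unfolding gps_norm_def[of \<Theta> t M] by (rule sum_le_gps_norm) (auto simp: gps_nth_finite)

text \<open>Comparing coefficients in \<open>(\<Sum>j\<le>n. A\<^sub>j x\<^sup>\<nu> \<delta>\<^sup>j \<psi>) = H\<close> inverts the operator on the left.\<close>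

lemma gps_norm_delta_le:
  assumes \<Theta>: "0 \<le> \<Theta>" and C: "0 \<le> C"
    and sym: "\<And>z j. m < Re z \<Longrightarrow> j \<le> n \<Longrightarrow> norm z ^ j \<le> C * norm (\<Sum>j\<le>n. A j * z ^ j)"
    and \<psi>: "\<And>\<mu>. gps_nth \<psi> \<mu> \<noteq> 0 \<Longrightarrow> m < Re \<mu>"
    and H: "\<And>\<mu>. gps_nth H (\<mu> + \<nu>) = (\<Sum>j\<le>n. A j * \<mu> ^ j) * gps_nth \<psi> \<mu>" and j: "j \<le> n"
  shows "gps_norm \<Theta> t M ((gps_delta ^^ j) \<psi>) \<le> C * gps_weight \<Theta> t (- \<nu>) * gps_norm \<Theta> t (M + Re \<nu>) H"
proof -
  define S where "S = {\<mu>. gps_nth ((gps_delta ^^ j) \<psi>) \<mu> \<noteq> 0 \<and> Re \<mu> \<le> M}"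
  have S: "finite S" by (simp add: S_def gps_nth_finite)
  let ?w = "gps_weight \<Theta> t"
  have "gps_norm \<Theta> t M ((gps_delta ^^ j) \<psi>) \<le>
      (\<Sum>\<mu>\<in>S. C * ?w (- \<nu>) * (norm (gps_nth H (\<mu> + \<nu>)) * ?w (\<mu> + \<nu>)))"
    unfolding gps_norm_def S_def[symmetric]
  proof (rule sum_mono)
    fix \<mu> assume "\<mu> \<in> S"
    then have \<mu>: "m < Re \<mu>" by (auto simp: S_def gps_nth_delta_pow intro: \<psi>)
    have "norm (gps_nth ((gps_delta ^^ j) \<psi>) \<mu>) = norm \<mu> ^ j * norm (gps_nth \<psi> \<mu>)"
      by (simp add: gps_nth_delta_pow norm_mult norm_power)
    also have "\<dots> \<le> (C * norm (\<Sum>j\<le>n. A j * \<mu> ^ j)) * norm (gps_nth \<psi> \<mu>)"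
      by (intro mult_right_mono sym \<mu> j) simp
    also have "\<dots> = C * norm (gps_nth H (\<mu> + \<nu>))" by (simp add: H norm_mult)
    finally have 1: "norm (gps_nth ((gps_delta ^^ j) \<psi>) \<mu>) \<le> C * norm (gps_nth H (\<mu> + \<nu>))" .
    \<comment> \<open>Dividing by \<open>x^\<nu>\<close> shifts exponents back by
      \<open>\<nu>\<close>, at the cost of the weight of \<open>- \<nu>\<close>.\<close>
    have 2: "?w \<mu> \<le> ?w (\<mu> + \<nu>) * ?w (- \<nu>)"
      using gps_weight_add[OF \<Theta>, of t "\<mu> + \<nu>" "- \<nu>"] by simp
    have "norm (gps_nth ((gps_delta ^^ j) \<psi>) \<mu>) * ?w \<mu> \<le>
        (C * norm (gps_nth H (\<mu> + \<nu>))) * (?w (\<mu> + \<nu>) * ?w (- \<nu>))"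
      using C by (intro mult_mono 1 2) (auto simp: gps_weight_pos less_imp_le)
    then show "norm (gps_nth ((gps_delta ^^ j) \<psi>) \<mu>) * ?w \<mu> \<le>
        C * ?w (- \<nu>) * (norm (gps_nth H (\<mu> + \<nu>)) * ?w (\<mu> + \<nu>))"
      by (simp add: mult_ac)
  qed
  also have "\<dots> = C * ?w (- \<nu>) * (\<Sum>\<mu>\<in>(\<lambda>\<mu>. \<mu> + \<nu>) ` S. norm (gps_nth H \<mu>) * ?w \<mu>)"
    by (simp add: sum_distrib_left sum.reindex inj_on_def)
  also have "\<dots> \<le> C * ?w (- \<nu>) * gps_norm \<Theta> t (M + Re \<nu>) H"
    using S C by (intro mult_left_mono sum_le_gps_norm) (auto simp: S_def gps_weight_pos less_imp_le)
  finally show ?thesis .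
qed

lemma eventually_exp_decay:
  fixes c a e :: real
  assumes "0 < a" "0 < e"
  shows "\<forall>\<^sub>F \<tau> in at_top. c * exp (- \<tau> * a) \<le> e"
proof -
  have "filterlim (\<lambda>\<tau>. a * \<tau>) at_top at_top"
    by (rule filterlim_tendsto_pos_mult_at_top[OF tendsto_const assms(1) filterlim_ident])
  then have "filterlim (\<lambda>\<tau>. - \<tau> * a) at_bot at_top"
    by (simp add: filterlim_uminus_at_bot mult.commute)
  then have "((\<lambda>\<tau>. c * exp (- \<tau> * a)) \<longlongrightarrow> c * 0) at_top"
    by (intro tendsto_intros filterlim_compose[OF exp_at_bot])
  then have "\<forall>\<^sub>F \<tau> in at_top. c * exp (- \<tau> * a) < e"
    using assms(2) by (intro order_tendstoD) auto
  then show ?thesis by (rule eventually_mono) simp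
qed

section \<open>The uniform bound for a formal solution\<close>

lemma gps_norm_bounded:
  fixes v :: "nat \<Rightarrow> 'm::finite" and F :: "complex ^ 'm \<Rightarrow> complex"
  assumes card: "CARD('m) = n + 2" and v: "bij_betw v {..<CARD('m)} UNIV"
    and F: "sep_holo r F" "0 < r" and \<phi>0: "gps_nth \<phi> 0 = 0"
    and eq: "gps_subst v F (gps_jet \<phi>) = 0"
    and lead: "\<And>j. j \<le> n \<Longrightarrow> gps_leading (gps_subst v (cpartial (v (Suc j)) F) (gps_jet \<phi>)) (A j) \<nu>"
    and An: "A n \<noteq> 0" and \<Theta>: "0 \<le> \<Theta>"
  obtains t B where "\<And>M. gps_norm \<Theta> t M \<phi> \<le> B"
proof -
  define \<sigma> where "\<sigma> = Re \<nu>"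
  \<comment> \<open>The remainder has no term at \<open>\<nu>\<close>, so the coefficient there is
    \<open>A n \<noteq> 0\<close>. Hence \<open>\<nu>\<close> is an admissible exponent and
    \<open>gps_single (A j) \<nu>\<close> takes its intended value.\<close>
  have \<nu>: "\<nu> = 0 \<or> 0 < Re \<nu>"
  proof -
    obtain R where R: "gps_small_o \<nu> R"
      "gps_nth (gps_subst v (cpartial (v (Suc n)) F) (gps_jet \<phi>)) \<nu> = A n + gps_nth R \<nu>"
      using lead[of n] unfolding gps_leading_def by auto
    then have "gps_nth R \<nu> = 0" unfolding gps_small_o_def by blast
    with R(2) An show ?thesis by (metis add.right_neutral gps_nth_supp)
  qed
  then have \<sigma>: "0 \<le> \<sigma>" by (auto simp: \<sigma>_def)

  obtain C m0 where C: "0 \<le> C"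
    and sym0: "\<And>z j. m0 < Re z \<Longrightarrow> j \<le> n \<Longrightarrow> norm z ^ j \<le> C * norm (\<Sum>j\<le>n. A j * z ^ j)"
    using symbol_lower_bound[of A n] An by metis
  \<comment> \<open>Beyond \<open>m0\<close> the symbol estimate holds. The bound
    \<open>\<sigma> + 2\<close> keeps the terms at \<open>\<nu>\<close> untouched by the truncation,
    lowers the cutoff in the quadratic term far enough, and leaves room for the choice of
    \<open>U\<close> below.\<close>
  define m where "m = max m0 (\<sigma> + 2)"
  have m: "m0 \<le> m" "\<sigma> + 2 \<le> m" "0 < m" using \<sigma> by (auto simp: m_def)
  have sym: "norm z ^ j \<le> C * norm (\<Sum>j\<le>n. A j * z ^ j)" if "m < Re z" "j \<le> n" for z j
    using sym0[of z j] m that by linarith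

  define \<phi>P where "\<phi>P = gps_trunc m \<phi>"
  define \<psi> where "\<psi> = \<phi> - \<phi>P"
  define P where "P = gps_jet \<phi>P"
  \<comment> \<open>The independent variable stays entirely in \<open>P\<close>, so its component in
    \<open>\<Psi>\<close> is 0.\<close>
  define \<Psi> :: "nat \<Rightarrow> gps" where "\<Psi> = case_nat 0 (\<lambda>j. (gps_delta ^^ j) \<psi>)"
  have \<psi>: "m < Re \<mu>" if "gps_nth \<psi> \<mu> \<noteq> 0" for \<mu>
    using that by (auto simp: \<psi>_def \<phi>P_def gps_nth_diff gps_trunc.rep_eq split: if_splits)
  have jet: "gps_jet \<phi> = (\<lambda>k. P k + \<Psi> k)"
    by (rule ext, rule gps_eqI)
      (auto simp: P_def \<Psi>_def gps_jet_def \<psi>_def gps_nth_add gps_nth_delta_pow gps_nth_diff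
        gps_nth_zero ring_distribs split: nat.split)
  have \<Psi>_ge: "gps_ge m (\<Psi> k)" for k
    unfolding gps_ge_def
    by (auto simp: \<Psi>_def gps_nth_zero gps_nth_delta_pow dest: \<psi> split: nat.splits)
  have P_supp: "Re \<mu> \<le> max m 1" if "gps_nth (P k) \<mu> \<noteq> 0" for k \<mu>
    using that
    by (auto simp: P_def gps_jet_def gps_nth_delta_pow \<phi>P_def gps_trunc.rep_eq gps_X.rep_eq
        split: nat.splits if_splits)
  have "gps_nth (P k) 0 = 0" for k
    unfolding P_def by (rule gps_nth_jet_0) (simp add: \<phi>P_def gps_trunc.rep_eq \<phi>0)
  then have "\<exists>d>0. gps_ge d (P k)" for k
    by (rule gps_ge_exists)
  then obtain dP where dP: "\<And>k. 0 < dP k \<and> gps_ge (dP k) (P k)"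
    by metis
  define d where "d = Min (insert m (dP ` {..<CARD('m)}))"
  have d: "0 < d" using dP m by (subst d_def, subst Min_gr_iff) auto
  have P_ge: "gps_ge d (P k)" if "k < CARD('m)" for k
    by (rule gps_ge_mono[OF conjunct2[OF dP]]) (use that in \<open>auto simp: d_def intro: Min_le\<close>)
  have \<Psi>_ged: "gps_ge d (\<Psi> k)" for k
    by (rule gps_ge_mono[OF \<Psi>_ge]) (auto simp: d_def intro: Min_le)

  define G where "G k = gps_subst v (cpartial (v k) F) P" for k
  define B where "B j = G (Suc j) - gps_single (A j) \<nu>" for j
  \<comment> \<open>Passing from the full jet to \<open>P\<close> changes the derivative of
    \<open>F\<close> only from real part \<open>m > \<sigma>\<close> on, so subtracting the leading
    term still leaves \<open>o(x^\<nu>)\<close>.\<close>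
  have B_small: "gps_small_o \<nu> (B j)" if j: "j \<le> n" for j
    unfolding gps_small_o_def
  proof (intro allI impI)
    fix \<mu> assume nz: "gps_nth (B j) \<mu> \<noteq> 0"
    obtain R where R: "gps_small_o \<nu> R"
      "\<And>\<mu>. gps_nth (gps_subst v (cpartial (v (Suc j)) F) (gps_jet \<phi>)) \<mu> = (if \<mu> = \<nu> then A j else 0) + gps_nth R \<mu>"
      using lead[OF j] unfolding gps_leading_def by blast
    let ?D = "gps_subst v (cpartial (v (Suc j)) F) (gps_jet \<phi>) - G (Suc j)"
    have D: "gps_ge m ?D"
      unfolding jet G_def by (rule gps_ge_subst_diff[OF v d P_ge \<Psi>_ged \<Psi>_ge])
    have "gps_nth (B j) \<mu> = gps_nth R \<mu> - gps_nth ?D \<mu>"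
      using R(2)[of \<mu>] \<nu> by (simp add: B_def gps_nth_diff gps_single.rep_eq)
    then have "gps_nth R \<mu> \<noteq> 0 \<or> gps_nth ?D \<mu> \<noteq> 0" using nz by auto
    then show "Re \<nu> < Re \<mu>"
    proof
      assume "gps_nth ?D \<mu> \<noteq> 0"
      then have "m \<le> Re \<mu>" using D unfolding gps_ge_def by blast
      then show ?thesis using m by (simp add: \<sigma>_def)
    qed (use R(1) in \<open>auto simp: gps_small_o_def\<close>)
  qed
  have "\<exists>e. j \<le> n \<longrightarrow> 0 < e \<and> gps_ge (\<sigma> + e) (B j)" for j
    using gps_small_o_gap[OF B_small, of j] unfolding \<sigma>_def by blast
  then obtain eB where eB: "\<And>j. j \<le> n \<Longrightarrow> 0 < eB j \<and> gps_ge (\<sigma> + eB j) (B j)"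
    by metis
  \<comment> \<open>A common gap for all \<open>B j\<close>, and the step length of the induction on
    the cutoff. Capping it by 1 ensures
    \<open>M + \<sigma> - m \<le> M - \<epsilon>\<close>.\<close>
  define \<epsilon> where "\<epsilon> = Min (insert 1 (eB ` {..n}))"
  have \<epsilon>: "0 < \<epsilon>" using eB by (subst \<epsilon>_def, subst Min_gr_iff) auto
  have \<epsilon>1: "\<epsilon> \<le> 1" unfolding \<epsilon>_def by (intro Min_le) auto
  have B_ge: "gps_ge (\<sigma> + \<epsilon>) (B j)" if "j \<le> n" for j
    by (rule gps_ge_mono[of "\<sigma> + eB j"]) (use that eB in \<open>auto simp: \<epsilon>_def intro: min.coboundedI2 Min_le\<close>)

  define Q where "Q = gps_subst_rem v F P \<Psi>"
  define FP where "FP = gps_subst v F P"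
  define H where "H = - (FP + (\<Sum>j\<le>n. B j * \<Psi> (Suc j)) + Q)"
  have sum_shift: "(\<Sum>k<CARD('m). G k * \<Psi> k) = (\<Sum>j\<le>n. G (Suc j) * \<Psi> (Suc j))"
    unfolding card by (simp add: sum.lessThan_Suc_shift lessThan_Suc_atMost[symmetric] \<Psi>_def del: sum.lessThan_Suc)
  \<comment> \<open>The first-order expansion at \<open>P\<close>, with the differential equation
    inserted and solved for \<open>F(P)\<close>.\<close>
  have FP_eq: "FP = - (\<Sum>j\<le>n. G (Suc j) * \<Psi> (Suc j)) - Q"
    unfolding Q_def gps_subst_rem_def FP_def G_def[symmetric] sum_shift jet[symmetric] eq by simp
  have H_eq: "(\<Sum>j\<le>n. gps_single (A j) \<nu> * \<Psi> (Suc j)) = H"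
    unfolding H_def FP_eq B_def by (simp add: left_diff_distrib sum_subtractf)
  have H_nth: "gps_nth H (\<mu> + \<nu>) = (\<Sum>j\<le>n. A j * \<mu> ^ j) * gps_nth \<psi> \<mu>" for \<mu>
    unfolding H_eq[symmetric] gps_nth_sum gps_nth_single_times[OF \<nu>]
    by (simp add: \<Psi>_def gps_nth_delta_pow sum_distrib_left sum_distrib_right mult_ac)
  have G_ge: "gps_ge \<sigma> (G (Suc j))" if "j \<le> n" for j
  proof -
    have "gps_ge \<sigma> (gps_single (A j) \<nu>)"
      by (auto simp: gps_ge_def gps_single.rep_eq \<sigma>_def split: if_splits)
    moreover have "gps_ge \<sigma> (B j)" using B_ge[OF that] \<epsilon> by (auto intro: gps_ge_mono)
    ultimately have "gps_ge \<sigma> (B j + gps_single (A j) \<nu>)" by (intro gps_ge_add)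
    then show ?thesis by (simp add: B_def)
  qed
  \<comment> \<open>The high order of \<open>F(P)\<close> is read off from \<open>FP_eq\<close>:
    each product has order at least \<open>\<sigma> + m\<close>, and \<open>Q\<close> even has order
    at least \<open>m + m\<close>.\<close>
  have FP_ge: "gps_ge (m + \<sigma>) FP"
  proof -
    have "gps_ge (\<sigma> + m) (\<Sum>j\<le>n. G (Suc j) * \<Psi> (Suc j))"
      by (intro gps_ge_sum gps_ge_times G_ge \<Psi>_ge) auto
    moreover have "gps_ge (\<sigma> + m) Q"
      unfolding Q_def using gps_ge_subst_rem[OF v F d P_ge \<Psi>_ged \<Psi>_ge]
      by (rule gps_ge_mono) (use m in auto)
    ultimately show ?thesis
      unfolding FP_eq by (subst add.commute) (intro gps_ge_diff gps_ge_uminus)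
  qed

  define s where "s = r / 2"
  have s: "0 < s" "s < r" using F by (simp_all add: s_def)
  obtain KF where KF: "0 \<le> KF" "\<And>\<alpha>. norm (taylor_coeff v F \<alpha>) \<le> KF / s ^ (\<Sum>i\<in>UNIV. \<alpha> i)"
    using taylor_coeff_bound[OF v F(1) s] by metis
  have "\<exists>K\<ge>0. \<forall>\<alpha>. norm (taylor_coeff v (cpartial (v (Suc j)) F) \<alpha>) \<le> K / s ^ (\<Sum>i\<in>UNIV. \<alpha> i)" for j
    using taylor_coeff_bound[OF v sep_holo_cpartial[OF F(1)] s] by metis
  then obtain KG where KG: "\<And>j. 0 \<le> KG j"
    "\<And>j \<alpha>. norm (taylor_coeff v (cpartial (v (Suc j)) F) \<alpha>) \<le> KG j / s ^ (\<Sum>i\<in>UNIV. \<alpha> i)"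
    by metis

  \<comment> \<open>\<open>P\<close> has finitely many exponents, all with positive real part, so
    its norms are bounded in \<open>M\<close> and tend to 0 as \<open>t\<close> grows. The bound
    \<open>s / 8\<close> leaves as much again for \<open>\<Psi>\<close> within the
    \<open>s / 4\<close> of \<open>gps_norm_subst_rem\<close>.\<close>
  obtain t0 where t0: "\<And>t M k. t0 \<le> t \<Longrightarrow> k < CARD('m) \<Longrightarrow> gps_norm \<Theta> t M (P k) \<le> s / 8"
  proof -
    define Z where "Z = (\<Sum>k<CARD('m). gps_norm \<Theta> 0 (max m 1) (P k))"
    have "\<forall>\<^sub>F \<tau> in at_top. Z * exp (- \<tau> * d) \<le> s / 8"
      using d s by (intro eventually_exp_decay) auto
    then obtain t1 where t1: "\<And>t. t1 \<le> t \<Longrightarrow> Z * exp (- t * d) \<le> s / 8"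
      by (auto simp: eventually_at_top_linorder)
    have "gps_norm \<Theta> t M (P k) \<le> s / 8" if t: "max 0 t1 \<le> t" and k: "k < CARD('m)" for t M k
    proof -
      have "gps_norm \<Theta> t M (P k) \<le> exp (- (t - 0) * d) * gps_norm \<Theta> 0 M (P k)"
        using t by (intro gps_norm_decay P_ge k) auto
      also have "\<dots> \<le> exp (- (t - 0) * d) * Z"
      proof (intro mult_left_mono)
        have "gps_norm \<Theta> 0 M (P k) \<le> gps_norm \<Theta> 0 (max m 1) (P k)"
          by (rule gps_norm_le_of_finite_support) (rule P_supp)
        also have "\<dots> \<le> Z" unfolding Z_def using k by (intro member_le_sum) (auto simp: gps_norm_nonneg)
        finally show "gps_norm \<Theta> 0 M (P k) \<le> Z" .
      qed simp
      also have "\<dots> \<le> s / 8" using t1[of t] t by (simp add: mult_ac)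
      finally show ?thesis .
    qed
    then show thesis by (rule that)
  qed

  \<comment> \<open>The constants are fixed at \<open>t0\<close>; afterwards only the increment
    \<open>\<tau>\<close> of \<open>t\<close> varies.\<close>
  define K1 where "K1 = KF * 2 ^ CARD('m)"
  define K2 where "K2 = (\<Sum>j\<le>n. KG j * 2 ^ CARD('m) + norm (A j) * gps_weight \<Theta> t0 \<nu>)"
  define K3 where "K3 = 64 * KF * 2 ^ CARD('m) / s\<^sup>2"
  define C' where "C' = C * gps_weight \<Theta> t0 (- \<nu>)"
  have pos: "0 \<le> K1" "0 \<le> K2" "0 \<le> K3" "0 \<le> C'"
    unfolding K1_def K2_def K3_def C'_def
    by (auto intro!: sum_nonneg add_nonneg_nonneg mult_nonneg_nonneg divide_nonneg_nonneg
        simp: KF(1) KG(1) C gps_weight_pos less_imp_le)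
  have P_norm: "gps_norm \<Theta> t0 M (P k) \<le> s / 2" if "k < CARD('m)" for M k
    using t0[OF order_refl that, of M] s by linarith
  have FP_norm: "gps_norm \<Theta> t0 M FP \<le> K1" for M
    unfolding FP_def K1_def by (rule gps_norm_subst[OF v \<Theta> P_ge d KF s(1) P_norm])
  have B_norm: "(\<Sum>j\<le>n. gps_norm \<Theta> t0 M (B j)) \<le> K2" for M
    unfolding K2_def
  proof (rule sum_mono)
    fix j
    have "gps_norm \<Theta> t0 M (G (Suc j)) \<le> KG j * 2 ^ CARD('m)"
      unfolding G_def by (rule gps_norm_subst[OF v \<Theta> P_ge d KG s(1) P_norm])
    then show "gps_norm \<Theta> t0 M (B j) \<le> KG j * 2 ^ CARD('m) + norm (A j) * gps_weight \<Theta> t0 \<nu>"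
      using gps_norm_add[of \<Theta> t0 M "G (Suc j)" "- gps_single (A j) \<nu>"] gps_norm_single[of \<Theta> t0 M "A j" \<nu>]
      unfolding B_def minus_gps_def gps_norm_uminus by linarith
  qed

  \<comment> \<open>One step of the induction, from cutoff \<open>M - \<epsilon>\<close> to
    \<open>M\<close>. Division by \<open>x^\<nu>\<close> costs
    \<open>exp (\<tau> * \<sigma>)\<close>. The orders of \<open>F(P)\<close> and of the
    \<open>B j\<close> more than compensate for it; in the quadratic term it is left to the
    smallness of \<open>U\<close>.\<close>
  have main: "gps_norm \<Theta> (t0 + \<tau>) M (\<Psi> k) \<le>
      C' * (K1 * exp (- \<tau> * m) + K2 * exp (- \<tau> * \<epsilon>) * U + K3 * exp (\<tau> * \<sigma>) * U\<^sup>2)"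
    if \<tau>: "0 \<le> \<tau>" and U: "0 \<le> U" "U \<le> s / 8" and k: "k < CARD('m)"
      and IH: "\<And>k. k < CARD('m) \<Longrightarrow> gps_norm \<Theta> (t0 + \<tau>) (M - \<epsilon>) (\<Psi> k) \<le> U" for \<tau> M U k
  proof (cases k)
    case 0
    then show ?thesis using pos U by (simp add: \<Psi>_def gps_norm_zero)
  next
    case (Suc j)
    then have j: "j \<le> n" using k card by simp
    let ?t = "t0 + \<tau>" and ?M = "M + \<sigma>"
    have w: "gps_weight \<Theta> ?t (- \<nu>) = gps_weight \<Theta> t0 (- \<nu>) * exp (\<tau> * \<sigma>)"
      by (simp add: gps_weight_def \<sigma>_def flip: exp_add) (simp add: algebra_simps)
    have 1: "gps_norm \<Theta> ?t ?M FP \<le> exp (- \<tau> * (m + \<sigma>)) * K1"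
    proof -
      have "gps_norm \<Theta> ?t ?M FP \<le> exp (- (?t - t0) * (m + \<sigma>)) * gps_norm \<Theta> t0 ?M FP"
        using \<tau> by (intro gps_norm_decay FP_ge) auto
      also have "\<dots> \<le> exp (- (?t - t0) * (m + \<sigma>)) * K1"
        by (intro mult_left_mono FP_norm) simp
      finally show ?thesis by simp
    qed
    have 2: "gps_norm \<Theta> ?t ?M (\<Sum>j\<le>n. B j * \<Psi> (Suc j)) \<le> exp (- \<tau> * (\<sigma> + \<epsilon>)) * K2 * U"
    proof -
      have "gps_norm \<Theta> ?t ?M (\<Sum>j\<le>n. B j * \<Psi> (Suc j)) \<le>
          (\<Sum>j\<le>n. (exp (- \<tau> * (\<sigma> + \<epsilon>)) * gps_norm \<Theta> t0 ?M (B j)) * U)"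
      proof (intro order_trans[OF gps_norm_sum] sum_mono)
        fix j assume "j \<in> {..n}"
        then have j: "j \<le> n" "Suc j < CARD('m)" using card by auto
        have "gps_norm \<Theta> ?t ?M (B j * \<Psi> (Suc j)) \<le>
            gps_norm \<Theta> ?t (?M - 0) (B j) * gps_norm \<Theta> ?t (?M - (\<sigma> + \<epsilon>)) (\<Psi> (Suc j))"
          by (intro gps_norm_mult \<Theta> B_ge j gps_ge_0)
        also have "\<dots> \<le> (exp (- \<tau> * (\<sigma> + \<epsilon>)) * gps_norm \<Theta> t0 ?M (B j)) * U"
        proof (rule mult_mono)
          show "gps_norm \<Theta> ?t (?M - 0) (B j) \<le> exp (- \<tau> * (\<sigma> + \<epsilon>)) * gps_norm \<Theta> t0 ?M (B j)"
            using gps_norm_decay[OF B_ge[OF j(1)], of t0 ?t \<Theta> ?M] \<tau> by simp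
          show "gps_norm \<Theta> ?t (?M - (\<sigma> + \<epsilon>)) (\<Psi> (Suc j)) \<le> U"
            using IH[OF j(2)] by simp
        qed (auto simp: gps_norm_nonneg)
        finally show "gps_norm \<Theta> ?t ?M (B j * \<Psi> (Suc j)) \<le>
            (exp (- \<tau> * (\<sigma> + \<epsilon>)) * gps_norm \<Theta> t0 ?M (B j)) * U" .
      qed
      also have "\<dots> = exp (- \<tau> * (\<sigma> + \<epsilon>)) * (\<Sum>j\<le>n. gps_norm \<Theta> t0 ?M (B j)) * U"
        by (simp add: sum_distrib_left sum_distrib_right)
      also have "\<dots> \<le> exp (- \<tau> * (\<sigma> + \<epsilon>)) * K2 * U"
        using U by (intro mult_right_mono mult_left_mono B_norm) auto
      finally show ?thesis .
    qed
    have 3: "gps_norm \<Theta> ?t ?M Q \<le> K3 * U\<^sup>2"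
      unfolding Q_def K3_def
    proof (rule gps_norm_subst_rem[OF v F \<Theta> d P_ge \<Psi>_ged _ \<Psi>_ge KF s(1)])
      show "gps_norm \<Theta> ?t ?M (P k) \<le> s / 8" if "k < CARD('m)" for k
        using \<tau> that by (intro t0) auto
      \<comment> \<open>The order \<open>m\<close> of \<open>\<Psi>\<close> pays for the shift by
        \<open>\<sigma>\<close> and still brings the cutoff below
        \<open>M - \<epsilon>\<close>.\<close>
      show "gps_norm \<Theta> ?t (?M - m) (\<Psi> k) \<le> U" if "k < CARD('m)" for k
        by (rule order_trans[OF gps_norm_mono IH[OF that]]) (use m \<epsilon>1 in auto)
    qed (use U m in auto)
    have H_le: "gps_norm \<Theta> ?t ?M H \<le> exp (- \<tau> * (m + \<sigma>)) * K1 + exp (- \<tau> * (\<sigma> + \<epsilon>)) * K2 * U + K3 * U\<^sup>2"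
      unfolding H_def gps_norm_uminus
      by (intro order_trans[OF gps_norm_add] add_mono 1 2 3)
    have "gps_norm \<Theta> ?t M (\<Psi> k) \<le> C * gps_weight \<Theta> ?t (- \<nu>) * gps_norm \<Theta> ?t ?M H"
      using gps_norm_delta_le[OF \<Theta> C sym \<psi> H_nth j, of ?t M] by (simp add: Suc \<Psi>_def \<sigma>_def)
    also have "\<dots> \<le> C * gps_weight \<Theta> ?t (- \<nu>) *
        (exp (- \<tau> * (m + \<sigma>)) * K1 + exp (- \<tau> * (\<sigma> + \<epsilon>)) * K2 * U + K3 * U\<^sup>2)"
      by (rule mult_left_mono[OF H_le]) (simp add: C gps_weight_pos less_imp_le)
    also have "\<dots> = C' * (K1 * (exp (\<tau> * \<sigma>) * exp (- \<tau> * (m + \<sigma>))) +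
        K2 * (exp (\<tau> * \<sigma>) * exp (- \<tau> * (\<sigma> + \<epsilon>))) * U + K3 * exp (\<tau> * \<sigma>) * U\<^sup>2)"
      unfolding w C'_def by (simp add: algebra_simps)
    also have "exp (\<tau> * \<sigma>) * exp (- \<tau> * (m + \<sigma>)) = exp (- \<tau> * m)"
      by (simp flip: exp_add) (simp add: algebra_simps)
    also have "exp (\<tau> * \<sigma>) * exp (- \<tau> * (\<sigma> + \<epsilon>)) = exp (- \<tau> * \<epsilon>)"
      by (simp flip: exp_add) (simp add: algebra_simps)
    finally show ?thesis .
  qed

  \<comment> \<open>The first three decay conditions allot a third of \<open>U\<close> to each term
    of \<open>main\<close>; the last one is \<open>U \<le> s / 8\<close>.\<close>
  have "\<forall>\<^sub>F \<tau> in at_top. 0 \<le> \<tau> \<and> (C' * K1) * exp (- \<tau> * 1) \<le> 1 / 3 \<and>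
      (C' * K2) * exp (- \<tau> * \<epsilon>) \<le> 1 / 3 \<and> (C' * K3) * exp (- \<tau> * 1) \<le> 1 / 3 \<and>
      1 * exp (- \<tau> * (\<sigma> + 1)) \<le> s / 8"
    using \<epsilon> s \<sigma> by (intro eventually_conj eventually_ge_at_top eventually_exp_decay) auto
  from eventually_happens'[OF trivial_limit_at_top_linorder this]
  obtain \<tau> where \<tau>: "0 \<le> \<tau>" "(C' * K1) * exp (- \<tau> * 1) \<le> 1 / 3"
      "(C' * K2) * exp (- \<tau> * \<epsilon>) \<le> 1 / 3" "(C' * K3) * exp (- \<tau> * 1) \<le> 1 / 3"
      "exp (- \<tau> * (\<sigma> + 1)) \<le> s / 8"
    unfolding mult_1 by blast
  \<comment> \<open>Small enough that \<open>exp (\<tau> * \<sigma>) * U\<close> is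
    \<open>exp (- \<tau>)\<close>, which tames the quadratic term; large enough that
    \<open>exp (- \<tau> * m) \<le> exp (- \<tau>) * U\<close>, because
    \<open>m \<ge> \<sigma> + 2\<close>.\<close>
  define U where "U = exp (- \<tau> * (\<sigma> + 1))"
  have U: "0 \<le> U" "U \<le> s / 8" using \<tau>(5) by (simp_all add: U_def)
  have step: "C' * (K1 * exp (- \<tau> * m) + K2 * exp (- \<tau> * \<epsilon>) * U + K3 * exp (\<tau> * \<sigma>) * U\<^sup>2) \<le> U"
  proof -
    have "exp (- \<tau> * m) \<le> exp (- \<tau> * 1) * U"
      unfolding U_def exp_add[symmetric] exp_le_cancel_iff
      using mult_left_mono[OF m(2) \<tau>(1)] by (simp add: algebra_simps)
    then have "C' * (K1 * exp (- \<tau> * m)) \<le> C' * (K1 * (exp (- \<tau> * 1) * U))"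
      by (intro mult_left_mono pos)
    also have "\<dots> = (C' * K1) * exp (- \<tau> * 1) * U" by simp
    also have "\<dots> \<le> 1 / 3 * U" by (intro mult_right_mono \<tau> U)
    finally have 1: "C' * (K1 * exp (- \<tau> * m)) \<le> 1 / 3 * U" .
    have 2: "(C' * K2) * exp (- \<tau> * \<epsilon>) * U \<le> 1 / 3 * U" by (intro mult_right_mono \<tau> U)
    have "exp (\<tau> * \<sigma>) * U = exp (- \<tau> * 1)"
      by (simp add: U_def flip: exp_add) (simp add: algebra_simps)
    then have "(C' * K3) * (exp (\<tau> * \<sigma>) * U) * U \<le> 1 / 3 * U"
      using \<tau>(4) U by (intro mult_right_mono) auto
    with 1 2 show ?thesis by (simp add: algebra_simps power2_eq_square)
  qed

  \<comment> \<open>Induction in steps of \<open>\<epsilon>\<close>. For \<open>M \<le> 0\<close>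
    the sum is empty, since the exponents of \<open>\<Psi>\<close> have real part at least
    \<open>m > 0\<close>.\<close>
  have bound: "gps_norm \<Theta> (t0 + \<tau>) M (\<Psi> k) \<le> U" if "M \<le> real i * \<epsilon>" "k < CARD('m)" for i M k
    using that
  proof (induction i arbitrary: M k)
    case 0
    have "{\<mu>. gps_nth (\<Psi> k) \<mu> \<noteq> 0 \<and> Re \<mu> \<le> M} = {}"
      using \<Psi>_ge[of k] m(3) 0 unfolding gps_ge_def by force
    then have "gps_norm \<Theta> (t0 + \<tau>) M (\<Psi> k) = 0"
      unfolding gps_norm_def by (simp only: sum.empty)
    then show ?case using U by simp
  next
    case (Suc i)
    have "M - \<epsilon> \<le> real i * \<epsilon>" using Suc.prems by (simp add: algebra_simps)
    from main[OF \<tau>(1) U Suc.prems(2) Suc.IH[OF this]] step show ?case by linarith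
  qed

  have "gps_norm \<Theta> (t0 + \<tau>) M \<phi> \<le> s / 8 + U" for M
  proof -
    obtain i :: nat where "M / \<epsilon> < real i" using reals_Archimedean2 by blast
    then have i: "M \<le> real i * \<epsilon>" using \<epsilon> by (simp add: pos_divide_less_eq)
    have "gps_norm \<Theta> (t0 + \<tau>) M (P 1 + \<Psi> 1) \<le> s / 8 + U"
      using card \<tau>(1) by (intro order_trans[OF gps_norm_add] add_mono t0 bound[OF i]) auto
    moreover have "P 1 + \<Psi> 1 = \<phi>"
      using fun_cong[OF jet, of 1] by (simp add: gps_jet_def)
    ultimately show ?thesis by simp
  qed
  then show thesis by (rule that)
qed

subsection \<open>Convergence in sectors\<close>

text \<open>In logarithmic coordinates the sector is a half-strip. This yields its openness through
  the open mapping theorem, and a connected domain on which to compare branches of the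
  logarithm.\<close>

lemma sector_eq_exp_image:
  assumes "0 < r"
  shows "sector \<theta>1 \<theta>2 r = exp ` {w. Re w < ln r \<and> \<theta>1 < Im w \<and> Im w < \<theta>2}"
proof (intro set_eqI iffI)
  fix x assume "x \<in> sector \<theta>1 \<theta>2 r"
  then obtain \<rho> \<theta> where x: "x = rcis \<rho> \<theta>" "0 < \<rho>" "\<rho> < r" "\<theta>1 < \<theta>" "\<theta> < \<theta>2"
    unfolding sector_def by blast
  then have "x = exp (Complex (ln \<rho>) \<theta>)"
    unfolding rcis_def exp_eq_polar by simp
  moreover have "ln \<rho> < ln r" using x by simp
  ultimately show "x \<in> exp ` {w. Re w < ln r \<and> \<theta>1 < Im w \<and> Im w < \<theta>2}"
    using x by auto
next
  fix x assume "x \<in> exp ` {w. Re w < ln r \<and> \<theta>1 < Im w \<and> Im w < \<theta>2}"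
  then obtain w where w: "x = exp w" "Re w < ln r" "\<theta>1 < Im w" "Im w < \<theta>2" by blast
  have "x = rcis (exp (Re w)) (Im w)" using w(1) by (simp add: exp_eq_polar rcis_def)
  moreover have "exp (Re w) < r" using w(2) assms by (metis exp_less_cancel_iff exp_ln)
  ultimately show "x \<in> sector \<theta>1 \<theta>2 r" using w unfolding sector_def by fastforce
qed

lemma strip_eq: "{w. Re w < a \<and> \<theta>1 < Im w \<and> Im w < \<theta>2} =
    {w. Re w < a} \<inter> ({w. \<theta>1 < Im w} \<inter> {w. Im w < \<theta>2})"
  by auto

lemma open_strip: "open {w. Re w < a \<and> \<theta>1 < Im w \<and> Im w < \<theta>2}"
  unfolding strip_eq by (intro open_Int open_halfspace_Re_lt open_halfspace_Im_gt open_halfspace_Im_lt)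

lemma connected_strip: "connected {w. Re w < a \<and> \<theta>1 < Im w \<and> Im w < \<theta>2}"
  unfolding strip_eq
  by (intro convex_connected convex_Int convex_halfspace_Re_lt convex_halfspace_Im_gt convex_halfspace_Im_lt)

lemma open_sector:
  assumes "0 < r"
  shows "open (sector \<theta>1 \<theta>2 r)"
  unfolding sector_eq_exp_image[OF assms]
proof (rule open_mapping_thm[where S = UNIV])
  show "\<not> (exp :: complex \<Rightarrow> complex) constant_on UNIV"
  proof
    assume "(exp :: complex \<Rightarrow> complex) constant_on UNIV"
    then have "exp (0 :: complex) = exp (complex_of_real 1)"
      unfolding constant_on_def by (metis UNIV_I)
    then have "(1 :: complex) = of_real (exp 1)" by (simp only: exp_of_real exp_zero)
    then have "exp (1 :: real) = 1" by (metis of_real_eq_1_iff)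
    then show False by simp
  qed
qed (auto intro: open_strip holomorphic_on_exp)

lemma sector_mono: "r \<le> R \<Longrightarrow> sector \<theta>1 \<theta>2 r \<subseteq> sector \<theta>1 \<theta>2 R"
  unfolding sector_def by force

lemma log_branch_Re:
  assumes "log_branch S L" "x \<in> S"
  shows "Re (L x) = ln (norm x)"
proof -
  have "norm x = exp (Re (L x))"
    using assms unfolding log_branch_def by (metis norm_exp_eq_Re)
  then show ?thesis by simp
qed

text \<open>\<open>L (exp w) - w\<close> is continuous on the connected half-strip with values in
  the integer multiples of 2 pi i, hence constant. So \<open>Im (L x)\<close> differs by a constant
  from an angle between \<open>\<theta>1\<close> and \<open>\<theta>2\<close>.\<close>

lemma log_branch_Im_bounded:
  assumes L: "log_branch (sector \<theta>1 \<theta>2 R) L" and R: "0 < R"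
  obtains \<Theta> where "0 \<le> \<Theta>" "\<And>x. x \<in> sector \<theta>1 \<theta>2 R \<Longrightarrow> \<bar>Im (L x)\<bar> \<le> \<Theta>"
proof -
  define W where "W = {w. Re w < ln R \<and> \<theta>1 < Im w \<and> Im w < \<theta>2}"
  have img: "sector \<theta>1 \<theta>2 R = exp ` W" unfolding W_def by (rule sector_eq_exp_image[OF R])
  define h where "h w = L (exp w) - w" for w
  have "continuous_on (exp ` W) L"
    using L unfolding log_branch_def img by (blast intro: holomorphic_on_imp_continuous_on)
  then have cont: "continuous_on W h"
    unfolding h_def by (intro continuous_intros continuous_on_compose2[of "exp ` W" L W exp]) auto
  have per: "\<exists>k::int. h w = of_int (2 * k) * pi * \<i>" if "w \<in> W" for w
  proof -
    have "exp (L (exp w)) = exp w" using L that unfolding log_branch_def img by blast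
    then obtain k :: int where "L (exp w) = w + (of_int (2 * k) * pi) * \<i>" by (auto simp: exp_eq)
    then have "h w = of_int (2 * k) * pi * \<i>" by (simp add: h_def)
    then show ?thesis by blast
  qed
  have "h constant_on W"
  proof (rule continuous_discrete_range_constant[OF _ cont])
    show "connected W" unfolding W_def by (rule connected_strip)
    fix w assume w: "w \<in> W"
    have "2 * pi \<le> norm (h y - h w)" if y: "y \<in> W" "h y \<noteq> h w" for y
    proof -
      obtain j k :: int where jk: "h w = of_int (2 * j) * pi * \<i>" "h y = of_int (2 * k) * pi * \<i>"
        using per[OF w] per[OF y(1)] by blast
      then have "k \<noteq> j" using y by auto
      then have "1 \<le> \<bar>real_of_int (k - j)\<bar>" by linarith
      moreover have "h y - h w = of_real (2 * pi * real_of_int (k - j)) * \<i>"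
        unfolding jk by (simp add: algebra_simps)
      then have "norm (h y - h w) = 2 * pi * \<bar>real_of_int (k - j)\<bar>"
        by (simp add: norm_mult abs_mult del: of_real_mult of_int_diff)
      ultimately show ?thesis using pi_gt_zero by simp
    qed
    then show "\<exists>e>0. \<forall>y. y \<in> W \<and> h y \<noteq> h w \<longrightarrow> e \<le> norm (h y - h w)"
      by (intro exI[of _ "2 * pi"]) auto
  qed
  then obtain b where b: "\<And>w. w \<in> W \<Longrightarrow> h w = b" unfolding constant_on_def by blast
  show thesis
  proof (rule that[of "\<bar>Im b\<bar> + (\<bar>\<theta>1\<bar> + \<bar>\<theta>2\<bar>)"])
    fix x assume "x \<in> sector \<theta>1 \<theta>2 R"
    then obtain w where w: "w \<in> W" "x = exp w" unfolding img by blast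
    have "L x = b + w" using b[OF w(1)] by (simp add: h_def w(2) algebra_simps)
    then have "Im (L x) = Im b + Im w" by simp
    moreover have "\<theta>1 < Im w" "Im w < \<theta>2" using w(1) by (auto simp: W_def)
    ultimately show "\<bar>Im (L x)\<bar> \<le> \<bar>Im b\<bar> + (\<bar>\<theta>1\<bar> + \<bar>\<theta>2\<bar>)" by linarith
  qed auto
qed

section \<open>From bounded norms to uniform convergence\<close>

lemma summable_of_gps_norm_bounded:
  assumes lam: "gps_exponents lam" and B: "\<And>M. gps_norm \<Theta> t M (gps_series c lam) \<le> B"
  shows "summable (\<lambda>k. norm (c k) * gps_weight \<Theta> t (lam k))"
proof (rule summableI_nonneg_bounded)
  fix N
  have inj: "inj_on lam {..<N}" using lam by (auto simp: gps_exponents_def intro: inj_on_subset)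
  have "(\<Sum>k<N. norm (c k) * gps_weight \<Theta> t (lam k)) =
      (\<Sum>\<mu>\<in>lam ` {..<N}. norm (gps_nth (gps_series c lam) \<mu>) * gps_weight \<Theta> t \<mu>)"
    by (simp add: sum.reindex[OF inj] gps_nth_series_lam[OF lam])
  \<comment> \<open>All real parts are positive, so their sum is a cutoff above each of the first
    \<open>N\<close> exponents.\<close>
  also have "\<dots> \<le> gps_norm \<Theta> t (\<Sum>k<N. Re (lam k)) (gps_series c lam)"
  proof (rule sum_le_gps_norm)
    fix \<mu> assume "\<mu> \<in> lam ` {..<N}"
    then show "Re \<mu> \<le> (\<Sum>k<N. Re (lam k))"
      using gps_exponents_Re_pos[OF lam] by (auto intro!: member_le_sum simp: less_imp_le)
  qed simp
  also have "\<dots> \<le> B" by (rule B)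
  finally show "(\<Sum>k<N. norm (c k) * gps_weight \<Theta> t (lam k)) \<le> B" .
qed (simp add: gps_weight_pos less_imp_le)

lemma norm_exp_le_gps_weight:
  assumes "Re l \<le> - t" "\<bar>Im l\<bar> \<le> \<Theta>" "0 \<le> Re \<mu>"
  shows "norm (exp (\<mu> * l)) \<le> gps_weight \<Theta> t \<mu>"
proof -
  have "Re \<mu> * Re l \<le> Re \<mu> * (- t)" using assms by (intro mult_left_mono)
  moreover have "- (Im \<mu> * Im l) \<le> \<bar>Im \<mu>\<bar> * \<bar>Im l\<bar>" by (metis abs_ge_minus_self abs_mult)
  moreover have "\<bar>Im \<mu>\<bar> * \<bar>Im l\<bar> \<le> \<bar>Im \<mu>\<bar> * \<Theta>" using assms by (intro mult_left_mono) auto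
  ultimately show ?thesis by (simp add: norm_exp_eq_Re gps_weight_def algebra_simps)
qed

theorem theorem5:
  fixes n :: nat
    and v :: "nat \<Rightarrow> 'm::finite"
    and F :: "complex ^ 'm \<Rightarrow> complex"
    and c lam :: "nat \<Rightarrow> complex"
    and A :: "nat \<Rightarrow> complex"
    and \<nu> :: complex
  assumes "n \<ge> 1"
    and "CARD('m) = n + 2"
    and "bij_betw v {..<n + 2} UNIV"
    and "holomorphic_near F 0"
    and "gps_exponents lam"
    and "gps_subst v F (gps_jet (gps_series c lam)) = 0"
    and "\<And>j. j \<le> n \<Longrightarrow>
      gps_leading (gps_subst v (cpartial (v (Suc j)) F) (gps_jet (gps_series c lam))) (A j) \<nu>"
    and "A n \<noteq> 0"
  shows "\<forall>\<theta>1 \<theta>2 R L. \<theta>1 < \<theta>2 \<and> \<theta>2 - \<theta>1 < 2 * pi \<and> 0 < R \<and> log_branch (sector \<theta>1 \<theta>2 R) L \<longrightarrow>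
    (\<exists>r0. 0 < r0 \<and> r0 \<le> R \<and> (\<forall>r. 0 < r \<and> r \<le> r0 \<longrightarrow>
      (\<exists>f. f holomorphic_on sector \<theta>1 \<theta>2 r \<and>
        uniform_limit (sector \<theta>1 \<theta>2 r) (\<lambda>N x. \<Sum>k<N. c k * exp (lam k * L x)) f sequentially)))"
proof (intro allI impI, elim conjE)
  fix \<theta>1 \<theta>2 R L
  assume R: "0 < R" and L: "log_branch (sector \<theta>1 \<theta>2 R) L"
  note lam = assms(5)
  have card: "CARD('m) = n + 2" and v: "bij_betw v {..<CARD('m)} UNIV" using assms(2,3) by simp_all
  obtain r where F: "0 < r" "sep_holo r F" using sep_holo_near[OF assms(4)] .
  \<comment> \<open>The angle bound is fixed first, on the whole given sector; the radius parameter
    \<open>t\<close> may then depend on it.\<close>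
  obtain \<Theta> where \<Theta>: "0 \<le> \<Theta>" "\<And>x. x \<in> sector \<theta>1 \<theta>2 R \<Longrightarrow> \<bar>Im (L x)\<bar> \<le> \<Theta>"
    using log_branch_Im_bounded[OF L R] by metis
  obtain t B where B: "\<And>M. gps_norm \<Theta> t M (gps_series c lam) \<le> B"
    using gps_norm_bounded[OF card v F(2,1) gps_nth_series_0[OF lam] assms(6,7,8) \<Theta>(1)] by metis
  show "\<exists>r0. 0 < r0 \<and> r0 \<le> R \<and> (\<forall>r. 0 < r \<and> r \<le> r0 \<longrightarrow>
      (\<exists>f. f holomorphic_on sector \<theta>1 \<theta>2 r \<and>
        uniform_limit (sector \<theta>1 \<theta>2 r) (\<lambda>N x. \<Sum>k<N. c k * exp (lam k * L x)) f sequentially))"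
  \<comment> \<open>For \<open>norm x < exp (- t)\<close> the real part of \<open>L x\<close> is at
    most \<open>- t\<close>, so the weights majorize the terms of the series.\<close>
  proof (intro exI[of _ "min R (exp (- t))"] conjI allI impI; (elim conjE)?)
    fix r assume r: "0 < r" "r \<le> min R (exp (- t))"
    have sub: "sector \<theta>1 \<theta>2 r \<subseteq> sector \<theta>1 \<theta>2 R" using r by (intro sector_mono) simp
    let ?f = "\<lambda>x. \<Sum>k. c k * exp (lam k * L x)"
    have ulim: "uniform_limit (sector \<theta>1 \<theta>2 r) (\<lambda>N x. \<Sum>k<N. c k * exp (lam k * L x)) ?f sequentially"
    proof (rule Weierstrass_m_test)
      fix k x assume x: "x \<in> sector \<theta>1 \<theta>2 r"
      then have xR: "x \<in> sector \<theta>1 \<theta>2 R" using sub by blast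
      have "0 < norm x" "norm x < r" using x by (auto simp: sector_def)
      then have "ln (norm x) \<le> ln (exp (- t))" using r by (subst ln_le_cancel_iff) auto
      then have "Re (L x) \<le> - t" using log_branch_Re[OF L xR] by simp
      then have "norm (exp (lam k * L x)) \<le> gps_weight \<Theta> t (lam k)"
        using \<Theta>(2)[OF xR] gps_exponents_Re_pos[OF lam, of k] by (intro norm_exp_le_gps_weight) auto
      then show "norm (c k * exp (lam k * L x)) \<le> norm (c k) * gps_weight \<Theta> t (lam k)"
        by (simp add: norm_mult mult_left_mono)
    qed (rule summable_of_gps_norm_bounded[OF lam B])
    have op: "open (sector \<theta>1 \<theta>2 r)" by (rule open_sector[OF r(1)])
    have hol: "?f holomorphic_on sector \<theta>1 \<theta>2 r"
    proof (rule holomorphic_uniform_sequence[OF op])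
      have "L holomorphic_on sector \<theta>1 \<theta>2 r"
        using L sub unfolding log_branch_def by (blast intro: holomorphic_on_subset)
      then show "(\<lambda>x. \<Sum>k<N. c k * exp (lam k * L x)) holomorphic_on sector \<theta>1 \<theta>2 r" for N
        by (intro holomorphic_intros)
      fix x assume "x \<in> sector \<theta>1 \<theta>2 r"
      then obtain d where "0 < d" "cball x d \<subseteq> sector \<theta>1 \<theta>2 r"
        using op open_contains_cball by blast
      then show "\<exists>d>0. cball x d \<subseteq> sector \<theta>1 \<theta>2 r \<and>
          uniform_limit (cball x d) (\<lambda>N x. \<Sum>k<N. c k * exp (lam k * L x)) ?f sequentially"
        using uniform_limit_on_subset[OF ulim] by blast
    qed
    show "\<exists>f. f holomorphic_on sector \<theta>1 \<theta>2 r \<and>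
        uniform_limit (sector \<theta>1 \<theta>2 r) (\<lambda>N x. \<Sum>k<N. c k * exp (lam k * L x)) f sequentially"
      using hol ulim by blast
  qed (use R in auto)
qed

end
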